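(* Let $D$ be a non-commutative division ring with center $F$, let $M$ be a non-abelian locally solvable maximal subgroup of $D^*$, and let $A$ be a maximal abelian normal subgroup of $M$. Put $L=F(A)$, $K=C_D(L)$ and $V=C_M(A)$. Then: (i) $A=L^*$; (ii) either $A=F^*$, or $V=L^*=K^*$ and $K$ is a maximal subfield of $D$.
   Context: $D^*$ is the multiplicative group of $D$; a maximal subgroup is a proper subgroup maximal among proper subgroups. Locally solvable: every finitely generated subgroup is solvable. A maximal abelian normal subgroup of $M$ is an abelian normal subgroup of $M$ not properly contained in another abelian normal subgroup of $M$. For a subset $S$, $F(S)$ is the division subring of $D$ generated by $F\cup S$; $C_D(S)=\{x\in D: xs=sx \ \forall s\in S\}$ and $C_M(S)=C_D(S)\cap M$. For a division subring $L$, $L^*=L\setminus\{0\}$. *)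

theory Defs
  imports Main "HOL-Algebra.Solvable_Groups" "HOL-Algebra.Generated_Groups"
begin

text \<open>The division ring D is the ambient type 'a :: division_ring (D = UNIV).\<close>

definition mgrp :: "'a::division_ring set \<Rightarrow> 'a monoid" where
  "mgrp S = \<lparr>carrier = S, mult = (*), one = 1\<rparr>"

definition units_D :: "'a::division_ring set" where
  "units_D = UNIV - {0}"

definition center_D :: "'a::division_ring set" where
  "center_D = {x. \<forall>y. x * y = y * x}"

definition centralizer :: "'a::division_ring set \<Rightarrow> 'a set" where
  "centralizer S = {x. \<forall>s\<in>S. x * s = s * x}"

definition abelian_set :: "'a::division_ring set \<Rightarrow> bool" where
  "abelian_set S \<longleftrightarrow> (\<forall>x\<in>S. \<forall>y\<in>S. x * y = y * x)"

definition locally_solvable :: "'a::division_ring set \<Rightarrow> bool" where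
  "locally_solvable M \<longleftrightarrow>
     (\<forall>S. finite S \<and> S \<subseteq> M \<longrightarrow> solvable (mgrp (generate (mgrp M) S)))"

definition maximal_subgroup_units :: "'a::division_ring set \<Rightarrow> bool" where
  "maximal_subgroup_units M \<longleftrightarrow>
     subgroup M (mgrp units_D) \<and> M \<noteq> units_D \<and>
     (\<forall>N. subgroup N (mgrp units_D) \<and> M \<subseteq> N \<longrightarrow> N = M \<or> N = units_D)"

definition max_abelian_normal :: "'a::division_ring set \<Rightarrow> 'a set \<Rightarrow> bool" where
  "max_abelian_normal A M \<longleftrightarrow>
     normal A (mgrp M) \<and> abelian_set A \<and>
     (\<forall>B. normal B (mgrp M) \<and> abelian_set B \<and> A \<subseteq> B \<longrightarrow> B = A)"

definition division_subring :: "'a::division_ring set \<Rightarrow> bool" where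
  "division_subring R \<longleftrightarrow> 0 \<in> R \<and> 1 \<in> R \<and>
     (\<forall>x\<in>R. \<forall>y\<in>R. x + y \<in> R \<and> x * y \<in> R) \<and>
     (\<forall>x\<in>R. - x \<in> R) \<and> (\<forall>x\<in>R. x \<noteq> 0 \<longrightarrow> inverse x \<in> R)"

definition gen_divring :: "'a::division_ring set \<Rightarrow> 'a set" where
  "gen_divring S = \<Inter>{R. division_subring R \<and> center_D \<union> S \<subseteq> R}"

definition maximal_subfield :: "'a::division_ring set \<Rightarrow> bool" where
  "maximal_subfield K \<longleftrightarrow> division_subring K \<and> abelian_set K \<and>
     (\<forall>K'. division_subring K' \<and> abelian_set K' \<and> K \<subseteq> K' \<longrightarrow> K' = K)"

end

theory Submission
  imports Defs
begin

text \<open>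
  A division subring \<open>R\<close> normalized by \<open>M\<close> either has \<open>R\<^sup>* \<subseteq> M\<close> or, by maximality of \<open>M\<close>,
  satisfies \<open>D\<^sup>* = M R\<^sup>*\<close>; in the second case \<open>R\<close> is normalized by \<open>D\<^sup>*\<close> and Cartan--Brauer--Hua
  makes it central or all of \<open>D\<close>. Applied to \<open>L = F(A)\<close> and \<open>K = C\<^sub>D(L)\<close>, this reduces the theorem to
  the commutativity of a division ring with locally solvable multiplicative group.

  Suppose such a ring is not commutative. The last noncentral term of the derived series of a
  finitely generated subgroup \<open>G\<close> is a normal subgroup \<open>N\<close> of class at most two. If
  \<open>x, x + 1 \<in> G\<close>, Hua's identity shows that \<open>x\<close> centralizes every abelian normal subgroup of
  \<open>G\<close>. Starting with \<open>G\<close> generated by \<open>x, x + 1, y, y + 1\<close> for noncommuting \<open>x, y\<close>, we find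
  \<open>u, v \<in> N\<close> with \<open>u v = z v u\<close>, where \<open>z \<noteq> 1\<close> commutes with \<open>u\<close> and \<open>v\<close>. Now repeat
  the construction with the generators \<open>u + t, v + t\<close>, where \<open>t\<close> ranges over five elements of
  the centre of the division ring generated by \<open>u\<close> and \<open>v\<close>. Linear independence of elements of
  \<open>N\<close> lying in distinct cosets of its centre turns the conjugates of \<open>w \<in> N\<close> by the \<open>u + t\<close>
  into relations that force \<open>w\<close> to commute with \<open>u\<close>, and similarly with \<open>v\<close>: a contradiction.
  If that centre has fewer than five elements, it is a field of order three or four, and \<open>u, v\<close>
  produce a zero divisor or a cube root of unity outside the centre.
\<close>

section \<open>Centralizers and Hua's identity\<close>

lemma inverse_cancel:
  fixes x y :: "'a::division_ring"
  assumes "x \<noteq> 0"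
  shows "inverse x * (x * y) = y" "x * (inverse x * y) = y"
  using assms by (simp_all flip: mult.assoc)

lemma left_commute:
  fixes x y z :: "'a::semigroup_mult"
  shows "x * y = y * x \<Longrightarrow> x * (y * z) = y * (x * z)"
  by (metis mult.assoc)

lemma division_subring_centralizer: "division_subring (centralizer S)"
proof -
  have "inverse x * s = s * inverse x" if "x \<noteq> 0" "x * s = s * x" for x s :: 'a
  proof -
    have "inverse x * s = inverse x * (s * x) * inverse x" using that(1) by (simp add: mult.assoc)
    also have "\<dots> = inverse x * (x * s) * inverse x" using that(2) by simp
    also have "\<dots> = s * inverse x" using that(1) by (simp flip: mult.assoc)
    finally show ?thesis .
  qed
  moreover have "x * y * s = s * (x * y)" if "x * s = s * x" "y * s = s * y" for x y s :: 'a
    using that by (metis mult.assoc)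
  ultimately show ?thesis
    by (auto simp: division_subring_def centralizer_def distrib_left distrib_right)
qed

lemma division_subringD:
  assumes "division_subring R"
  shows "0 \<in> R" "1 \<in> R"
    "x \<in> R \<Longrightarrow> y \<in> R \<Longrightarrow> x + y \<in> R" "x \<in> R \<Longrightarrow> y \<in> R \<Longrightarrow> x * y \<in> R"
    "x \<in> R \<Longrightarrow> - x \<in> R" "x \<in> R \<Longrightarrow> inverse x \<in> R"
    "x \<in> R \<Longrightarrow> y \<in> R \<Longrightarrow> x - y \<in> R"
proof -
  show "0 \<in> R" "1 \<in> R"
    "x \<in> R \<Longrightarrow> y \<in> R \<Longrightarrow> x + y \<in> R" "x \<in> R \<Longrightarrow> y \<in> R \<Longrightarrow> x * y \<in> R"
    "x \<in> R \<Longrightarrow> - x \<in> R"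
    using assms by (auto simp: division_subring_def)
  show "x \<in> R \<Longrightarrow> inverse x \<in> R"
    using assms by (cases "x = 0") (auto simp: division_subring_def)
  show "x \<in> R \<Longrightarrow> y \<in> R \<Longrightarrow> x - y \<in> R"
    using assms unfolding division_subring_def by (metis add_uminus_conv_diff)
qed

lemmas centralizer_closed = division_subringD[OF division_subring_centralizer]

lemma centralizerD: "x \<in> centralizer S \<Longrightarrow> s \<in> S \<Longrightarrow> x * s = s * x"
  by (simp add: centralizer_def)

lemma centralizer_singleton: "x \<in> centralizer {s} \<longleftrightarrow> x * s = s * x"
  by (simp add: centralizer_def)

lemma commute_inverse:
  fixes x y :: "'a::division_ring"
  shows "x * y = y * x \<Longrightarrow> inverse x * y = y * inverse x"
  using centralizer_closed(6)[of x "{y}"] by (simp add: centralizer_def)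

text \<open>Hua's identity: subtract the first equation from the second and move
  \<open>v * t\<close> across. When \<open>v \<noteq> u\<close>, it recovers \<open>x\<close> from
  \<open>u\<close>, \<open>v\<close>, \<open>w\<close> and \<open>t\<close>.\<close>

lemma conj_shift_identity:
  fixes t u v w x :: "'a::ring"
  assumes "u * x = x * w" "v * (x + t) = (x + t) * w" "t * v = v * t"
  shows "(v - u) * x = t * (w - v)"
  using assms by (simp add: algebra_simps)

lemma conj_mult_cancel:
  fixes u w x :: "'a::division_ring"
  shows "x \<noteq> 0 \<Longrightarrow> x * w * inverse x * x = x * w"
  by (simp add: mult.assoc)

text \<open>If the conjugates of \<open>w\<close> by \<open>x\<close> and \<open>x + t\<close>
  coincide, Hua's identity makes both equal to \<open>w\<close>; otherwise it writes
  \<open>x\<close> as a product of elements commuting with \<open>w\<close>.\<close>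

lemma commute_abelian_of_shift:
  fixes x w t :: "'a::division_ring"
  assumes A: "abelian_set A" "w \<in> A" "x * w * inverse x \<in> A"
      "(x + t) * w * inverse (x + t) \<in> A"
    and t: "t \<noteq> 0" "\<And>a. a \<in> A \<Longrightarrow> t * a = a * t"
  shows "x * w = w * x"
proof (cases "x = 0 \<or> x + t = 0")
  case True
  then have "x = 0 \<or> x = - t" by (auto simp: eq_neg_iff_add_eq_0)
  then show ?thesis using t(2)[OF A(2)] by auto
next
  case False
  define u where "u = x * w * inverse x"
  define v where "v = (x + t) * w * inverse (x + t)"
  have u: "u * x = x * w" and v: "v * (x + t) = (x + t) * w"
    using False by (auto simp: u_def v_def conj_mult_cancel)
  have eq: "(v - u) * x = t * (w - v)"
    using conj_shift_identity[OF u v] t(2) A(4) by (simp add: v_def)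
  have cw: "u * w = w * u" "v * w = w * v" "t * w = w * t"
    using A t(2) by (auto simp: abelian_set_def u_def v_def)
  show ?thesis
  proof (cases "v = u")
    case True
    then have "w = v" using eq t(1) by simp
    then show ?thesis using u True by simp
  next
    case False
    then have "x = inverse (v - u) * (t * (w - v))"
      by (simp add: inverse_cancel flip: eq)
    moreover have "\<dots> \<in> centralizer {w}"
      by (intro centralizer_closed) (auto simp: centralizer_def cw)
    ultimately show ?thesis by (simp add: centralizer_def)
  qed
qed

text \<open>An element outside \<open>L\<close> commutes with \<open>a\<close>, since otherwise
  Hua's identity with shift 1 expresses it through elements of \<open>L\<close>. So any
  \<open>c\<close> not commuting with \<open>a\<close> lies in \<open>L\<close>, and then
  \<open>b\<close> and \<open>b + c\<close> both lie outside, which makes \<open>c\<close> commute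
  with \<open>a\<close> after all.\<close>

lemma Cartan_Brauer_Hua:
  fixes L :: "'a::division_ring set"
  assumes L: "division_subring L" and norm: "\<And>d a. d \<noteq> 0 \<Longrightarrow> a \<in> L \<Longrightarrow> d * a * inverse d \<in> L"
  shows "L = UNIV \<or> L \<subseteq> center_D"
proof (rule ccontr)
  assume "\<not> ?thesis"
  then obtain b a c where b: "b \<notin> L" and a: "a \<in> L" and c: "a * c \<noteq> c * a"
    by (auto simp: center_D_def)
  have out: "x * a = a * x" if x: "x \<notin> L" for x
  proof (rule ccontr)
    assume nc: "x * a \<noteq> a * x"
    have nz: "x \<noteq> 0" "x + 1 \<noteq> 0"
      using x division_subringD(1,2,5)[OF L] by (auto simp: add_eq_0_iff2)
    define u v where "u = x * a * inverse x" and "v = (x + 1) * a * inverse (x + 1)"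
    have uv: "u * x = x * a" "v * (x + 1) = (x + 1) * a" "u \<in> L" "v \<in> L"
      using nz norm a by (auto simp: u_def v_def conj_mult_cancel)
    have eq: "(v - u) * x = 1 * (a - v)"
      using conj_shift_identity[OF uv(1,2)] by simp
    show False
    proof (cases "v = u")
      case True
      then show False using eq uv(1) nc by simp
    next
      case False
      then have "x = inverse (v - u) * (a - v)" using inverse_cancel(1)[of "v - u" x] eq by simp
      also have "\<dots> \<in> L" using uv a by (intro division_subringD[OF L]) auto
      finally show False using x by simp
    qed
  qed
  have "c \<in> L" using out c by metis
  then have "b + c \<notin> L" using b division_subringD(7)[OF L, of "b + c" c] by auto
  then show False using out[OF b] out[of "b + c"] c by (simp add: algebra_simps)
qed

section \<open>Subgroups of class two\<close>

text \<open>A subgroup of the units of nilpotency class at most two. \<open>centralizer B\<close> is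
  taken in all of \<open>D\<close>: it is a division subring, possibly noncommutative, and supplies
  the coefficients of linear relations between elements of \<open>B\<close>.\<close>

locale class_two =
  fixes B :: "'a::division_ring set"
  assumes zero_notin: "0 \<notin> B" and one_in: "1 \<in> B"
    and mult_in: "a \<in> B \<Longrightarrow> b \<in> B \<Longrightarrow> a * b \<in> B"
    and inverse_in: "a \<in> B \<Longrightarrow> inverse a \<in> B"
    and commutator_central:
      "a \<in> B \<Longrightarrow> b \<in> B \<Longrightarrow> a * b * inverse a * inverse b \<in> centralizer B"
begin

text \<open>The eigenvalue of \<open>b\<close> under conjugation by \<open>g\<close>. For fixed
  \<open>b\<close> in \<open>B\<close> it is a character of \<open>B\<close> with values in the
  centre of \<open>B\<close>.\<close>

definition chr :: "'a \<Rightarrow> 'a \<Rightarrow> 'a" where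
  "chr b g = g * b * inverse g * inverse b"

text \<open>For elements of \<open>B\<close> this means lying in the same coset of the centre of
  \<open>B\<close>.\<close>

definition eqv :: "'a \<Rightarrow> 'a \<Rightarrow> bool" where
  "eqv b d \<longleftrightarrow> b * inverse d \<in> centralizer B"

lemma nonzero: "b \<in> B \<Longrightarrow> b \<noteq> 0"
  using zero_notin by auto

lemma chr_in: "b \<in> B \<Longrightarrow> g \<in> B \<Longrightarrow> chr b g \<in> centralizer B \<inter> B"
  using commutator_central by (auto simp: chr_def mult_in inverse_in)

lemma conj_chr: "b \<in> B \<Longrightarrow> g \<in> B \<Longrightarrow> g * b = chr b g * b * g"
  using nonzero by (simp add: chr_def mult.assoc)

lemma eqv_iff: "b \<in> B \<Longrightarrow> d \<in> B \<Longrightarrow> eqv b d \<longleftrightarrow> (\<exists>\<zeta> \<in> centralizer B \<inter> B. b = \<zeta> * d)"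
proof -
  assume B: "b \<in> B" "d \<in> B"
  have "b = b * inverse d * d" using nonzero[OF B(2)] by (simp add: mult.assoc)
  moreover have "\<zeta> * d * inverse d = \<zeta>" for \<zeta> using nonzero[OF B(2)] by (simp add: mult.assoc)
  ultimately show ?thesis unfolding eqv_def by (metis B Int_iff inverse_in mult_in)
qed

text \<open>A central factor does not change the eigenvalue; conversely, equal eigenvalues cancel in
  the conjugates of \<open>b * inverse d\<close>. So different cosets of the centre carry different
  characters.\<close>

lemma chr_cong_iff:
  assumes B: "b \<in> B" "d \<in> B"
  shows "(\<forall>g\<in>B. chr b g = chr d g) \<longleftrightarrow> eqv b d"
proof
  assume "eqv b d"
  then obtain \<zeta> where z: "\<zeta> \<in> centralizer B" "\<zeta> \<in> B" "b = \<zeta> * d" using B by (auto simp: eqv_iff)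
  show "\<forall>g\<in>B. chr b g = chr d g"
  proof
    fix g assume g: "g \<in> B"
    have "chr d g * b * g = chr d g * \<zeta> * d * g" by (simp add: z mult.assoc)
    also have "\<dots> = \<zeta> * (chr d g * d * g)"
      using centralizerD[OF z(1), of "chr d g"] chr_in[OF B(2) g] by (simp add: mult.assoc left_commute)
    also have "\<dots> = \<zeta> * g * d" using conj_chr[OF B(2) g] by (simp add: mult.assoc)
    also have "\<dots> = g * b" using centralizerD[OF z(1) g] by (simp add: z mult.assoc)
    also have "\<dots> = chr b g * b * g" using conj_chr[OF B(1) g] .
    finally show "chr b g = chr d g" using nonzero g B by simp
  qed
next
  assume *: "\<forall>g\<in>B. chr b g = chr d g"
  have "b * inverse d * g = g * (b * inverse d)" if g: "g \<in> B" for g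
  proof -
    have c: "chr d g \<in> centralizer B" "chr d g \<noteq> 0"
      using chr_in[OF B(2) g] nonzero by auto
    have "g * d = chr d g * d * g" by (rule conj_chr[OF B(2) g])
    then have "inverse d * (g * d) * inverse d = inverse d * (chr d g * d * g) * inverse d" by simp
    then have 1: "inverse d * g = inverse d * chr d g * d * g * inverse d"
      using nonzero[OF B(2)] by (simp add: mult.assoc)
    have "inverse d * chr d g * d = chr d g"
      using centralizerD[OF c(1) B(2)] nonzero[OF B(2)] by (simp add: mult.assoc inverse_cancel)
    then have 2: "inverse d * g = chr d g * g * inverse d" using 1 by simp
    have "b * inverse d * g = b * chr d g * g * inverse d" using 2 by (simp add: mult.assoc)
    also have "\<dots> = chr d g * b * g * inverse d" using centralizerD[OF c(1) B(1)] by simp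
    also have "\<dots> = g * b * inverse d" using conj_chr[OF B(1) g] * g by simp
    finally show ?thesis by (simp add: mult.assoc)
  qed
  then show "eqv b d" by (simp add: eqv_def centralizer_def)
qed

lemma eqv_refl [simp]: "b \<in> B \<Longrightarrow> eqv b b"
  using chr_cong_iff by blast

lemma eqv_sym: "b \<in> B \<Longrightarrow> d \<in> B \<Longrightarrow> eqv b d \<longleftrightarrow> eqv d b"
  by (metis chr_cong_iff)

lemma eqv_trans: "a \<in> B \<Longrightarrow> b \<in> B \<Longrightarrow> c \<in> B \<Longrightarrow> eqv a b \<Longrightarrow> eqv b c \<Longrightarrow> eqv a c"
  by (metis chr_cong_iff)

lemma eqv_one_iff: "eqv b 1 \<longleftrightarrow> b \<in> centralizer B"
  by (simp add: eqv_def)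

lemma eqv_mult_right_iff:
  "a \<in> B \<Longrightarrow> b \<in> B \<Longrightarrow> c \<in> B \<Longrightarrow> eqv (a * c) (b * c) \<longleftrightarrow> eqv a b"
  using nonzero by (simp add: eqv_def nonzero_inverse_mult_distrib mult.assoc inverse_cancel)

text \<open>This is Dedekind's independence of characters, for \<open>B\<close> acting by conjugation.\<close>

lemma isotypic_component:
  assumes "set xs \<subseteq> centralizer B \<times> B" "(\<Sum>(c, b)\<leftarrow>xs. c * b) = 0" "d \<in> B"
  shows "(\<Sum>(c, b)\<leftarrow>filter (\<lambda>(c, b). eqv b d) xs. c * b) = 0"
  using assms(1,2)
proof (induction "length xs" arbitrary: xs rule: less_induct)
  case less
  show ?case
  proof (cases "\<forall>(c, b)\<in>set xs. eqv b d")
    case True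
    then have "filter (\<lambda>(c, b). eqv b d) xs = xs" by (auto intro!: filter_True)
    then show ?thesis using less.prems by simp
  next
    case False
    then obtain c' b' where cb: "(c', b') \<in> set xs" "\<not> eqv b' d" by auto
    obtain ys zs where xs: "xs = ys @ (c', b') # zs" using cb(1) by (meson split_list)
    have b': "b' \<in> B" using cb less.prems by auto
    obtain g where g: "g \<in> B" "chr b' g \<noteq> chr d g" using cb(2) b' assms(3) chr_cong_iff by blast
    \<comment> \<open>Conjugating the relation by \<open>g\<close> and subtracting
      \<open>chr b' g\<close> times the original kills the term of \<open>b'\<close>, while every
      term in the class of \<open>d\<close> is scaled by the same nonzero factor
      \<open>chr d g - chr b' g\<close>. The relation has become shorter.\<close>
    define F where "F = (\<lambda>(c, b). ((chr b g - chr b' g) * c, b))"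
    define us where "us = ys @ zs"
    have sub: "set us \<subseteq> centralizer B \<times> B" using less.prems xs by (auto simp: us_def)
    have conj: "g * (\<Sum>(c, b)\<leftarrow>vs. c * b) = (\<Sum>(c, b)\<leftarrow>vs. chr b g * c * b) * g"
      if "set vs \<subseteq> centralizer B \<times> B" for vs
      using that
    proof (induction vs)
      case (Cons v vs)
      obtain c b where v: "v = (c, b)" "c \<in> centralizer B" "b \<in> B" using Cons.prems by (cases v) auto
      have "g * (c * b) = c * (g * b)" using centralizerD[OF v(2) g(1)] by (metis mult.assoc)
      also have "\<dots> = c * chr b g * b * g" using conj_chr[OF v(3) g(1)] by (simp add: mult.assoc)
      also have "\<dots> = chr b g * c * b * g"
        using centralizerD[OF v(2), of "chr b g"] chr_in[OF v(3) g(1)] by simp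
      finally show ?case using Cons v by (simp add: distrib_left distrib_right)
    qed simp
    have lin: "(\<Sum>(c, b)\<leftarrow>map F vs. c * b) = (\<Sum>(c, b)\<leftarrow>vs. chr b g * c * b) - chr b' g * (\<Sum>(c, b)\<leftarrow>vs. c * b)" for vs
      by (induction vs) (auto simp: F_def algebra_simps)
    have "(\<Sum>(c, b)\<leftarrow>map F xs. c * b) = 0"
      unfolding lin using conj[OF less.prems(1)] less.prems(2) nonzero[OF g(1)] by simp
    then have sum0: "(\<Sum>(c, b)\<leftarrow>map F us. c * b) = 0" by (simp add: xs us_def F_def)
    have "F v \<in> centralizer B \<times> B" if "v \<in> centralizer B \<times> B" for v
    proof -
      obtain c b where v: "v = (c, b)" "c \<in> centralizer B" "b \<in> B" using \<open>v \<in> _\<close> by (cases v) auto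
      have "chr b g \<in> centralizer B" "chr b' g \<in> centralizer B" using chr_in v(3) b' g(1) by auto
      then have "(chr b g - chr b' g) * c \<in> centralizer B" using v(2) by (intro centralizer_closed)
      then show ?thesis using v by (simp add: F_def)
    qed
    then have F_in: "set (map F us) \<subseteq> centralizer B \<times> B" using sub
      unfolding set_map by (meson image_subsetI subsetD)
    have "(\<Sum>(c, b)\<leftarrow>filter (\<lambda>(c, b). eqv b d) (map F us). c * b) = 0"
      by (rule less.hyps[OF _ F_in sum0]) (simp add: xs us_def)
    moreover have "(\<Sum>(c, b)\<leftarrow>filter (\<lambda>(c, b). eqv b d) (map F vs). c * b) =
        (chr d g - chr b' g) * (\<Sum>(c, b)\<leftarrow>filter (\<lambda>(c, b). eqv b d) vs. c * b)"
      if "set vs \<subseteq> centralizer B \<times> B" for vs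
      using that
    proof (induction vs)
      case (Cons v vs)
      obtain c b where v: "v = (c, b)" "c \<in> centralizer B" "b \<in> B" using Cons.prems by (cases v) auto
      have "chr b g = chr d g" if "eqv b d" using that chr_cong_iff[OF v(3) assms(3)] g(1) by blast
      then show ?case using Cons v by (auto simp: F_def distrib_left mult.assoc)
    qed simp
    ultimately have "(\<Sum>(c, b)\<leftarrow>filter (\<lambda>(c, b). eqv b d) us. c * b) = 0" using sub g(2) by simp
    then show ?thesis using cb(2) by (simp add: xs us_def)
  qed
qed

end

section \<open>Relations between inverses of \<open>p - 1\<close> for \<open>p\<close> in a class
  two group\<close>

lemma eq_one_or_minus_one:
  fixes x :: "'a::division_ring"
  assumes "x * x = 1" shows "x = 1 \<or> x = -1"
proof -
  have "(x - 1) * (x + 1) = 0" using assms by (simp add: algebra_simps)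
  then show ?thesis by (auto simp: eq_neg_iff_add_eq_0)
qed

text \<open>The second factor equals \<open>(p - 1) * (c * p - 1) * inverse p\<close>. Thus the
  difference of the two inverses is \<open>c - 1\<close> divided by a Laurent polynomial in
  \<open>p\<close>, to which independence applies once denominators are cleared.\<close>

lemma inverse_minus_one_diff:
  fixes c p :: "'a::division_ring"
  assumes "p \<noteq> 0" "p \<noteq> 1" "c * p \<noteq> 1" "c * p = p * c"
  shows "(inverse (p - 1) - inverse (c * p - 1)) * (c * p - c - 1 + inverse p) = c - 1"
    and "c * p - c - 1 + inverse p \<noteq> 0"
proof -
  let ?W = "c * p - c - 1 + inverse p"
  have W1: "?W = (p - 1) * ((c * p - 1) * inverse p)" and W2: "?W = (c * p - 1) * ((p - 1) * inverse p)"
    using assms(1) by (simp_all add: algebra_simps left_commute[OF assms(4)[symmetric]] flip: assms(4))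
  have "inverse (p - 1) * ?W = c - inverse p"
    unfolding W1 using assms(1,2) by (simp add: inverse_cancel) (simp add: left_diff_distrib mult.assoc)
  moreover have "inverse (c * p - 1) * ?W = 1 - inverse p"
    unfolding W2 using assms(1,3) by (simp add: inverse_cancel) (simp add: left_diff_distrib)
  ultimately show "(inverse (p - 1) - inverse (c * p - 1)) * ?W = c - 1"
    by (simp add: left_diff_distrib)
  show "?W \<noteq> 0" unfolding W1 using assms by simp
qed

lemma conj_inverse:
  fixes a y z :: "'a::division_ring"
  assumes "a \<noteq> 0" "a * y = z * a"
  shows "a * inverse y = inverse z * a"
proof (cases "y = 0")
  case True
  then show ?thesis using assms by auto
next
  case False
  then have "z \<noteq> 0" using assms by auto
  have "a * inverse y = inverse z * (z * a) * inverse y" using \<open>z \<noteq> 0\<close> by (simp add: inverse_cancel mult.assoc)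
  also have "\<dots> = inverse z * a" using False by (simp add: mult.assoc flip: assms(2))
  finally show ?thesis .
qed

context class_two
begin

text \<open>The relation forces \<open>p\<close> and \<open>q\<close> to commute as well. Clearing
  denominators then leaves a linear relation between \<open>p * q\<close>, \<open>p\<close>,
  \<open>q\<close>, \<open>a * q\<close>, \<open>a * p\<close> and \<open>a\<close>, in which the
  constant terms cancel.\<close>

lemma commuting_relation_False:
  assumes B: "a \<in> B" "p \<in> B" "q \<in> B"
    and ne: "\<not> eqv a 1" "\<not> eqv p 1" "\<not> eqv q 1" "\<not> eqv a p" "\<not> eqv a q" "\<not> eqv p q"
    and ts: "t \<in> centralizer B" "s \<in> centralizer B" "t \<noteq> 0" "s \<noteq> 0"
    and rel: "(t - s) * inverse (a - 1) = t * inverse (p - 1) - s * inverse (q - 1)"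
    and comm: "a * p = p * a" "a * q = q * a"
  shows False
proof -
  have n1: "a \<noteq> 1" "p \<noteq> 1" "q \<noteq> 1" using ne one_in by auto
  \<comment> \<open>All other terms of the relation commute with \<open>p\<close>, hence so do
    \<open>inverse (q - 1)\<close> and \<open>q\<close>.\<close>
  have "s * inverse (q - 1) = t * inverse (p - 1) - (t - s) * inverse (a - 1)" using rel by simp
  also have "\<dots> \<in> centralizer {p}"
    by (intro centralizer_closed) (use B ts comm in \<open>auto simp: centralizer_def\<close>)
  finally have "inverse s * (s * inverse (q - 1)) \<in> centralizer {p}"
    using ts B by (metis centralizer_closed(4,6) centralizerD centralizer_singleton)
  then have "inverse (q - 1) \<in> centralizer {p}" using ts(4) by (simp add: inverse_cancel)
  then have "inverse (inverse (q - 1)) + 1 \<in> centralizer {p}"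
    by (rule centralizer_closed(3)[OF centralizer_closed(6) centralizer_closed(2)])
  then have pq: "p * q = q * p" by (simp add: centralizer_def)
  let ?m = "(a - 1) * ((p - 1) * (q - 1))"
  have m: "?m = (p - 1) * ((a - 1) * (q - 1))" "?m = (q - 1) * ((a - 1) * (p - 1))"
    by (simp_all add: algebra_simps comm pq left_commute[OF comm(1)] left_commute[OF comm(2)] left_commute[OF pq])
  have "(t - s) * (inverse (a - 1) * ?m) = t * (inverse (p - 1) * ?m) - s * (inverse (q - 1) * ?m)"
    using arg_cong[OF rel, of "\<lambda>y. y * ?m"] by (simp only: left_diff_distrib mult.assoc)
  then have "(t - s) * ((p - 1) * (q - 1)) = t * ((a - 1) * (q - 1)) - s * ((a - 1) * (p - 1))"
    using n1 by (subst (asm) (3) m(2), subst (asm) (2) m(1)) (simp add: inverse_cancel)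
  then have sum0: "(\<Sum>(c, b)\<leftarrow>[(t - s, p * q), (- t, p), (s, q), (- t, a * q), (s, a * p), (t - s, a)]. c * b) = 0"
    by (simp add: algebra_simps)
  have sub: "set [(t - s, p * q), (- t, p), (s, q), (- t, a * q), (s, a * p), (t - s, a)] \<subseteq> centralizer B \<times> B"
    using B ts by (auto intro!: centralizer_closed mult_in)
  have ne': "\<not> eqv (p * q) p" "\<not> eqv (p * q) q" "\<not> eqv (a * p) p" "\<not> eqv (a * q) q" "\<not> eqv q p"
    using eqv_mult_right_iff[OF B(3) one_in B(2)] eqv_mult_right_iff[OF B(2) one_in B(3)]
      eqv_mult_right_iff[OF B(1) one_in B(2)] eqv_mult_right_iff[OF B(1) one_in B(3)]
      ne pq eqv_sym B by auto
  \<comment> \<open>Only \<open>a * q\<close> can share the coset of \<open>p\<close>, so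
    \<open>p = - (a * q)\<close>. Likewise \<open>q = - (a * p)\<close>, and together these give
    \<open>a * a = 1\<close>.\<close>
  have "t * p + t * (if eqv (a * q) p then a * q else 0) = 0"
    using isotypic_component[OF sub sum0 B(2)] ne ne' B(1-3) by (simp split: if_splits) (metis add.left_inverse)
  then have "t * (p + (if eqv (a * q) p then a * q else 0)) = 0" by (simp only: distrib_left)
  then have p: "p = - (a * q)" using ts(3) nonzero[OF B(2)] by (auto simp: eq_neg_iff_add_eq_0 split: if_splits)
  have "s * q + s * (if eqv (a * p) q then a * p else 0) = 0"
    using isotypic_component[OF sub sum0 B(3)] ne ne' B(1-3) by (simp split: if_splits)
  then have "s * (q + (if eqv (a * p) q then a * p else 0)) = 0" by (simp only: distrib_left)
  then have q: "q = - (a * p)" using ts(4) nonzero[OF B(3)] by (auto simp: eq_neg_iff_add_eq_0 split: if_splits)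
  have "a * a * p = 1 * p" using p q by (simp add: mult.assoc)
  then have "a * a = 1" using nonzero[OF B(2)] by (simp del: mult_1_left)
  then have "a \<in> centralizer B" by (auto dest!: eq_one_or_minus_one simp: centralizer_def)
  then show False using ne by (simp add: eqv_one_iff)
qed

text \<open>Conjugating by \<open>a\<close> changes only the terms with \<open>p\<close> and
  \<open>q\<close>. Comparing the two versions eliminates \<open>a\<close> and leaves a linear
  relation between \<open>1\<close>, \<open>p\<close>, \<open>q\<close> and the inverses of
  \<open>p\<close> and \<open>q\<close>, which independence cannot allow if \<open>q\<close> and
  \<open>inverse p\<close> lie in different cosets.\<close>

lemma noncommuting_relation_eqv:
  assumes B: "a \<in> B" "p \<in> B" "q \<in> B"
    and ne: "\<not> eqv p 1" "\<not> eqv q 1" "\<not> eqv p q"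
    and ts: "t \<in> centralizer B" "s \<in> centralizer B" "t \<noteq> 0" "s \<noteq> 0" "t * s = s * t"
    and rel: "(t - s) * inverse (a - 1) = t * inverse (p - 1) - s * inverse (q - 1)"
    and nc: "a * p \<noteq> p * a"
  shows "eqv q (inverse p)"
proof (rule ccontr)
  assume qp: "\<not> eqv q (inverse p)"
  define \<chi> \<psi> where "\<chi> = chr p a" and "\<psi> = chr q a"
  have chi: "\<chi> \<in> centralizer B" "\<chi> \<in> B" "a * p = \<chi> * p * a"
    and psi: "\<psi> \<in> centralizer B" "\<psi> \<in> B" "a * q = \<psi> * q * a"
    unfolding \<chi>_def \<psi>_def
    using chr_in[OF B(2,1)] conj_chr[OF B(2,1)] chr_in[OF B(3,1)] conj_chr[OF B(3,1)] by blast+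
  have n: "p \<noteq> 0" "p \<noteq> 1" "\<chi> * p \<noteq> 1" "q \<noteq> 0" "q \<noteq> 1" "\<psi> * q \<noteq> 1" "\<chi> \<noteq> 1" "a \<noteq> 0"
  proof -
    have *: "c * b \<noteq> 1" if "c \<in> centralizer B" "b \<in> B" "\<not> eqv b 1" for c b
    proof
      assume "c * b = 1"
      then have "b = inverse c" by (metis inverse_unique)
      then show False using that centralizer_closed(6) by (auto simp: eqv_one_iff)
    qed
    show "\<chi> * p \<noteq> 1" "\<psi> * q \<noteq> 1" using * chi psi B ne by auto
    show "p \<noteq> 0" "p \<noteq> 1" "q \<noteq> 0" "q \<noteq> 1" "a \<noteq> 0" using ne nonzero B one_in by auto
    show "\<chi> \<noteq> 1" using chi nc by auto
  qed
  define P P' Q Q' A where "P = inverse (p - 1)" and "P' = inverse (\<chi> * p - 1)"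
    and "Q = inverse (q - 1)" and "Q' = inverse (\<psi> * q - 1)" and "A = inverse (a - 1)"
  have conj: "a * P = P' * a" "a * Q = Q' * a" "a * A = A * a"
    unfolding P_def P'_def Q_def Q'_def A_def
    by (rule conj_inverse[OF n(8)]; simp add: algebra_simps chi(3) psi(3))+
  have rel': "(t - s) * A = t * P - s * Q" using rel by (simp add: P_def Q_def A_def)
  have ta: "t * a = a * t" "s * a = a * s" using ts(1,2) B(1) by (auto simp: centralizer_def)
  \<comment> \<open>Conjugation by \<open>a\<close> fixes the left side of the relation and replaces
    \<open>p\<close>, \<open>q\<close> by \<open>\<chi> * p\<close>, \<open>\<psi> * q\<close>; the
    right side therefore survives this substitution.\<close>
  have "(t * P' - s * Q') * a = t * (a * P) - s * (a * Q)"
    by (simp add: left_diff_distrib mult.assoc conj)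
  also have "\<dots> = a * (t * P - s * Q)" by (simp add: right_diff_distrib left_commute[OF ta(1)] left_commute[OF ta(2)])
  also have "\<dots> = a * ((t - s) * A)" by (simp add: rel')
  also have "\<dots> = (t - s) * A * a"
    using ta by (simp add: algebra_simps conj left_commute[of a t] left_commute[of a s])
  finally have "t * P' - s * Q' = t * P - s * Q" using n(8) by (simp add: rel')
  then have D: "t * (P - P') = s * (Q - Q')" by (simp add: algebra_simps)
  \<comment> \<open>\<open>\<Delta>\<close> is the common value of both sides of \<open>D\<close>.
    Multiplication by \<open>Wp\<close> or \<open>Wq\<close> turns it into \<open>k1\<close> or
    \<open>k2\<close> in \<open>centralizer B\<close>, so eliminating it gives
    \<open>k2 * Wp = k1 * Wq\<close>.\<close>
  define \<Delta> Wp Wq k1 k2 where "\<Delta> = t * (P - P')" and "Wp = \<chi> * p - \<chi> - 1 + inverse p"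
    and "Wq = \<psi> * q - \<psi> - 1 + inverse q" and "k1 = t * (\<chi> - 1)" and "k2 = s * (\<psi> - 1)"
  have DW: "\<Delta> * Wp = k1" "\<Delta> * Wq = k2" "Wq \<noteq> 0"
  proof -
    show "\<Delta> * Wp = k1"
      unfolding \<Delta>_def Wp_def k1_def mult.assoc P_def P'_def
      using inverse_minus_one_diff(1)[OF n(1-3)] centralizerD[OF chi(1) B(2)] by simp
    show "\<Delta> * Wq = k2"
      unfolding \<Delta>_def D Wq_def k2_def mult.assoc Q_def Q'_def
      using inverse_minus_one_diff(1)[OF n(4-6)] centralizerD[OF psi(1) B(3)] by simp
    show "Wq \<noteq> 0"
      unfolding Wq_def using inverse_minus_one_diff(2)[OF n(4-6)] centralizerD[OF psi(1) B(3)] by simp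
  qed
  have k1: "k1 \<in> centralizer B" "k1 \<noteq> 0" using ts chi n by (auto simp: k1_def intro!: centralizer_closed)
  have "\<Delta> \<noteq> 0" using DW(1) k1(2) by auto
  have k2: "k2 \<in> centralizer B" "k2 \<noteq> 0" using ts psi DW(2,3) \<open>\<Delta> \<noteq> 0\<close>
    by (auto simp: k2_def intro!: centralizer_closed)
  have "k1 * s = s * k1"
  proof -
    have "t \<in> centralizer {s}" "\<chi> \<in> centralizer {s}"
      using ts(5) centralizerD[OF ts(2) chi(2)] by (simp_all add: centralizer_singleton)
    then have "k1 \<in> centralizer {s}" unfolding k1_def by (intro centralizer_closed)
    then show ?thesis by (simp add: centralizer_singleton)
  qed
  then have "s \<in> centralizer {k1}" "\<psi> \<in> centralizer {k1}"
    using centralizerD[OF k1(1) psi(2)] by (simp_all add: centralizer_singleton)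
  then have "k2 \<in> centralizer {k1}" unfolding k2_def by (intro centralizer_closed)
  then have k12: "k1 * k2 = k2 * k1" by (simp add: centralizer_singleton)
  have "b \<in> centralizer {k}" if "k \<in> centralizer B" "b \<in> B" for k b
    using centralizerD[OF that] by (simp add: centralizer_singleton)
  then have "Wp \<in> centralizer {k2}" "Wq \<in> centralizer {k1}"
    unfolding Wp_def Wq_def using k1(1) k2(1) B chi(2) psi(2)
    by (blast intro: centralizer_closed)+
  then have "\<Delta> * (k2 * Wp - k1 * Wq) = \<Delta> * Wp * k2 - \<Delta> * Wq * k1"
    by (simp add: centralizer_singleton right_diff_distrib mult.assoc)
  also have "\<dots> = 0" by (simp add: DW k12)
  finally have eq0: "k2 * Wp - k1 * Wq = 0" using \<open>\<Delta> \<noteq> 0\<close> by simp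
  let ?l = "[(k2 * \<chi>, p), (- k2 * (\<chi> + 1), 1), (k2, inverse p),
             (- k1 * \<psi>, q), (k1 * (\<psi> + 1), 1), (- k1, inverse q)]"
  have sum0: "(\<Sum>(c, b)\<leftarrow>?l. c * b) = 0"
    using eq0 by (simp add: Wp_def Wq_def algebra_simps)
  have sub: "set ?l \<subseteq> centralizer B \<times> B"
    using B k1 k2 chi psi one_in by (auto intro!: centralizer_closed inverse_in)
  have ne': "\<not> eqv 1 q" "\<not> eqv (inverse p) q" using ne qp eqv_sym B one_in inverse_in by auto
  have psi1: "\<psi> \<noteq> 1" "\<psi> \<noteq> 0" using k2(2) psi nonzero by (auto simp: k2_def)
  \<comment> \<open>In the coset of \<open>q\<close> there can only be \<open>q\<close> itself and
    perhaps \<open>inverse q\<close>.\<close>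
  have "k1 * \<psi> * q + k1 * (if eqv (inverse q) q then inverse q else 0) = 0"
    using isotypic_component[OF sub sum0 B(3)] ne ne' B(1-3) by (simp split: if_splits) (metis add.left_inverse)
  then have "k1 * (\<psi> * q + (if eqv (inverse q) q then inverse q else 0)) = 0"
    by (simp only: distrib_left mult.assoc)
  then have "\<psi> * q + inverse q = 0" using k1(2) psi1 n(4) by (auto split: if_splits)
  then have "(\<psi> * q + inverse q) * q = 0" by simp
  then have qq: "\<psi> * (q * q) = - 1" using n(4) by (simp add: distrib_right mult.assoc eq_neg_iff_add_eq_0)
  then have qq': "q * q = - inverse \<psi>" using psi1(2) by (metis inverse_cancel(1) mult_minus_right mult_1_right)
  have "q * q \<in> centralizer B" unfolding qq' by (intro centralizer_closed psi)
  \<comment> \<open>Conjugation by \<open>a\<close> multiplies \<open>q * q\<close> by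
    \<open>\<psi> * \<psi>\<close> but also fixes it.\<close>
  then have "(q * q) * a = a * (q * q)" using B(1) by (simp add: centralizer_def)
  also have "\<dots> = \<psi> * q * (a * q)" by (metis psi(3) mult.assoc)
  also have "\<dots> = \<psi> * \<psi> * (q * q) * a"
    using left_commute[OF centralizerD[OF psi(1) B(3)]] by (simp add: psi(3) mult.assoc)
  finally have "1 * (q * q * a) = \<psi> * \<psi> * (q * q * a)" by (simp add: mult.assoc)
  then have "\<psi> * \<psi> = 1" using n(4,8) by (metis mult_right_cancel no_zero_divisors)
  then have "\<psi> = - 1" using psi1 by (auto dest!: eq_one_or_minus_one)
  then have "q * q = 1" using qq by simp
  then have "q \<in> centralizer B" by (auto dest!: eq_one_or_minus_one simp: centralizer_def)
  then show False using ne by (simp add: eqv_one_iff)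
qed

end

definition normalizes :: "'a::division_ring \<Rightarrow> 'a set \<Rightarrow> bool" where
  "normalizes y B \<longleftrightarrow> y \<noteq> 0 \<and> (\<lambda>b. y * b * inverse y) ` B = B"

lemma obtain_three:
  assumes "3 \<le> card S" obtains a b c where "a \<in> S" "b \<in> S" "c \<in> S" "a \<noteq> b" "a \<noteq> c" "b \<noteq> c"
proof -
  obtain R where "R \<subseteq> S" "card R = 3" using assms by (metis obtain_subset_with_card_n)
  then show thesis using that by (auto simp: card_3_iff)
qed

section \<open>Class two subgroups normalized by translates\<close>

text \<open>A configuration to be refuted; \<open>x\<close> need not lie in \<open>B\<close>. Five
  translates are required because at most one of the conjugates of \<open>w\<close> lies in the
  coset of \<open>w\<close>, and the final argument uses a base point and three more.\<close>

locale noncommuting_shifts = class_two B for B :: "'a::division_ring set" +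
  fixes x w :: 'a and T :: "'a set"
  assumes T_central: "T \<subseteq> centralizer B" and T_abelian: "abelian_set T"
    and norm: "t \<in> T \<Longrightarrow> normalizes (x + t) B"
    and card_T: "5 \<le> card T"
    and w: "w \<in> B" and nc: "x * w \<noteq> w * x"
begin

definition wt :: "'a \<Rightarrow> 'a" where "wt t = (x + t) * w * inverse (x + t)"

lemma T_commute: "t \<in> T \<Longrightarrow> b \<in> B \<Longrightarrow> t * b = b * t"
  using T_central by (auto simp: centralizer_def)

lemma wt_in: "t \<in> T \<Longrightarrow> wt t \<in> B"
  using norm w unfolding normalizes_def wt_def by blast

lemma wt_eq: "t \<in> T \<Longrightarrow> wt t * (x + t) = (x + t) * w"
  using norm unfolding wt_def by (simp add: conj_mult_cancel normalizes_def)

lemma wt_neq: "t \<in> T \<Longrightarrow> wt t \<noteq> w"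
proof
  assume "t \<in> T" "wt t = w"
  then show False using wt_eq[of t] T_commute[of t w] w nc by (simp add: algebra_simps)
qed

text \<open>If two conjugates differed by a central factor \<open>\<zeta>\<close>, then
  \<open>x\<close> would be, up to the factor \<open>1 - \<zeta>\<close>, the sum of a multiple of
  some \<open>b\<close> in \<open>B\<close> and an element of \<open>centralizer B\<close>. Each
  translate then yields a square root \<open>X r\<close> of one fixed element, and there are too
  many translates for that.\<close>

lemma wt_inequiv:
  assumes ts: "t \<in> T" "s \<in> T" "t \<noteq> s"
  shows "\<not> eqv (wt s) (wt t)"
proof
  assume "eqv (wt s) (wt t)"
  then obtain \<zeta> where z: "\<zeta> \<in> centralizer B" "\<zeta> \<in> B" "wt s = \<zeta> * wt t"
    using eqv_iff wt_in ts by auto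
  \<comment> \<open>These come from \<open>\<mu> * w = wt t * (x + t) - wt s * (x + s)\<close>; the
    outcome is \<open>k * (x + r) = \<mu> * b + X r\<close> for all \<open>r\<close>.\<close>
  define \<mu> k b where "\<mu> = t - s" and "k = 1 - \<zeta>" and "b = inverse (wt t) * w"
  define X where "X r = k * r - t + \<zeta> * s" for r
  define \<epsilon> where "\<epsilon> = chr w b"
  have t0: "wt t \<noteq> 0" and w0: "w \<noteq> 0" using nonzero wt_in ts(1) w by auto
  have b: "b \<in> B" using mult_in inverse_in wt_in ts(1) w by (simp add: b_def)
  have mu: "\<mu> \<in> centralizer B" "\<mu> \<noteq> 0" using T_central ts by (auto simp: \<mu>_def intro!: centralizer_closed)
  have k: "k \<in> centralizer B" unfolding k_def using z by (intro centralizer_closed)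
  have X: "X r \<in> centralizer B" if "r \<in> T" for r
  proof -
    have "r \<in> centralizer B" "t \<in> centralizer B" "s \<in> centralizer B" using that T_central ts by auto
    then show ?thesis unfolding X_def using z k by (intro centralizer_closed)
  qed
  have XT: "X r \<in> centralizer T" if "r \<in> T" for r
  proof -
    have "\<zeta> \<in> centralizer T" using T_commute[OF _ z(2)] by (auto simp: centralizer_def)
    moreover from this have "k \<in> centralizer T" unfolding k_def by (intro centralizer_closed)
    moreover have "r \<in> centralizer T" "t \<in> centralizer T" "s \<in> centralizer T"
      using T_abelian ts that by (auto simp: centralizer_def abelian_set_def)
    ultimately show ?thesis unfolding X_def by (intro centralizer_closed)
  qed
  have "\<mu> * w = (x + t) * w - (x + s) * w" by (simp add: \<mu>_def algebra_simps)
  also have "\<dots> = wt t * (x + t) - \<zeta> * (wt t * (x + s))"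
    using wt_eq[OF ts(1)] wt_eq[OF ts(2)] by (simp add: z(3) mult.assoc)
  also have "\<dots> = wt t * ((x + t) - \<zeta> * (x + s))"
    using left_commute[OF centralizerD[OF z(1) wt_in[OF ts(1)]]] by (simp add: right_diff_distrib)
  finally have "inverse (wt t) * (\<mu> * w) = (x + t) - \<zeta> * (x + s)" using t0 by (simp add: inverse_cancel)
  then have mub: "\<mu> * b = (x + t) - \<zeta> * (x + s)"
    using left_commute[OF centralizerD[OF mu(1) inverse_in[OF wt_in[OF ts(1)]]]] by (simp add: b_def)
  then have kx: "k * (x + r) = \<mu> * b + X r" for r by (simp add: X_def k_def algebra_simps)
  have "\<zeta> \<noteq> 1"
  proof
    assume "\<zeta> = 1"
    then have "\<mu> * b = \<mu> * 1" using mub by (simp add: \<mu>_def)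
    then have "b = 1" using mu(2) by (simp del: mult_1_right)
    then have "wt t * b = wt t" by simp
    then show False using wt_neq[OF ts(1)] t0 by (simp add: b_def inverse_cancel)
  qed
  then have k0: "k \<noteq> 0" by (simp add: k_def)
  have nb: "\<not> eqv b 1"
  proof
    assume "eqv b 1"
    then have "b \<in> centralizer B" by (simp add: eqv_one_iff)
    then have "\<mu> * b + X t \<in> centralizer B" using mu X[OF ts(1)] by (intro centralizer_closed)
    then have "k * (x + t) * w = w * (k * (x + t))" using w by (simp add: kx centralizer_def)
    also have "\<dots> = k * (w * (x + t))" using centralizerD[OF k w] left_commute by metis
    finally have "(x + t) * w = w * (x + t)" using k0 by (simp add: mult.assoc)
    then show False using nc T_commute[OF ts(1) w] by (simp add: algebra_simps)
  qed
  have eps: "\<epsilon> \<in> centralizer B" "\<epsilon> \<in> B" "b * w = \<epsilon> * w * b"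
    using chr_in[OF w b] conj_chr[OF w b] by (auto simp: \<epsilon>_def)
  \<comment> \<open>The equation defining \<open>wt r\<close> becomes a relation between
    \<open>b\<close>, \<open>1\<close>, \<open>g * b\<close> and \<open>g\<close>. Independence
    splits it into \<open>X r = \<mu> * (g * b)\<close> and
    \<open>\<mu> * \<epsilon> * b = X r * g\<close>, and their combination no longer involves
    \<open>g\<close>.\<close>
  have sq: "X r * X r = \<mu> * \<mu> * \<epsilon> * (b * b)" if r: "r \<in> T" "X r \<noteq> 0" for r
  proof -
    define g where "g = inverse w * wt r"
    have g: "g \<in> B" "g \<noteq> 1"
      using mult_in inverse_in wt_in r(1) w wt_neq[OF r(1)] w0 inverse_cancel(2)[OF w0, of "wt r"] by (auto simp: g_def)
    have c: "\<mu> * y = y * \<mu>" "X r * y = y * X r" "\<epsilon> * y = y * \<epsilon>" if "y \<in> B" for y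
      using that mu(1) X[OF r(1)] eps(1) by (auto simp: centralizer_def)
    have "(\<mu> * b + X r) * w = k * ((x + r) * w)" by (simp add: mult.assoc flip: kx)
    also have "\<dots> = k * (wt r * (x + r))" by (simp add: wt_eq[OF r(1)])
    also have "\<dots> = wt r * (k * (x + r))" using left_commute[OF centralizerD[OF k wt_in[OF r(1)]]] .
    also have "\<dots> = wt r * (\<mu> * b + X r)" by (simp add: kx)
    finally have "inverse w * ((\<mu> * b + X r) * w) = g * (\<mu> * b + X r)"
      by (simp add: g_def mult.assoc)
    moreover have "(\<mu> * b + X r) * w = w * (\<mu> * \<epsilon> * b + X r)"
      using c(1)[OF w] c(2)[OF w] c(3)[OF w] left_commute[OF c(1)[OF w]] left_commute[OF c(3)[OF w]]
      by (simp add: distrib_left distrib_right mult.assoc eps(3))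
    ultimately have "\<mu> * \<epsilon> * b + X r = g * (\<mu> * b + X r)" using w0 by (simp add: inverse_cancel)
    also have "\<dots> = \<mu> * (g * b) + X r * g"
      using left_commute[OF c(1)[OF g(1)]] c(2)[OF g(1)] by (simp add: distrib_left)
    finally have eq: "\<mu> * \<epsilon> * b + X r = \<mu> * (g * b) + X r * g" .
    let ?l = "[(\<mu> * \<epsilon>, b), (X r, 1), (- \<mu>, g * b), (- X r, g)]"
    have sum0: "(\<Sum>(c, b)\<leftarrow>?l. c * b) = 0" using eq by (simp add: add.assoc[symmetric])
    have sub: "set ?l \<subseteq> centralizer B \<times> B"
      using mu eps X[OF r(1)] b g one_in by (auto intro!: centralizer_closed mult_in)
    have ng: "\<not> eqv g 1"
    proof
      assume "eqv g 1"
      moreover from this have "\<not> eqv (g * b) 1"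
        using eqv_mult_right_iff[OF g(1) one_in b] nb eqv_sym eqv_trans b g one_in mult_in by (metis mult_1_left)
      ultimately have "X r = X r * g"
        using isotypic_component[OF sub sum0 one_in] nb one_in by simp
      then show False using r(2) g(2) by simp
    qed
    have Xg: "X r = \<mu> * (g * b)"
      using isotypic_component[OF sub sum0 one_in] nb ng one_in r(2) by (simp split: if_splits)
    then have gb: "\<mu> * \<epsilon> * b = X r * g" using eq by simp
    have "X r * X r = X r * (\<mu> * (g * b))" using Xg by simp
    also have "\<dots> = \<mu> * (X r * g) * b"
    proof -
      have "X r * \<mu> = \<mu> * X r"
      proof -
        show ?thesis using centralizerD[OF XT[OF r(1)] ts(1)] centralizerD[OF XT[OF r(1)] ts(2)]
          by (simp add: \<mu>_def algebra_simps)
      qed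
      then show ?thesis using left_commute[of "X r" \<mu>] by (simp add: mult.assoc)
    qed
    also have "\<dots> = \<mu> * \<mu> * \<epsilon> * (b * b)" by (simp add: mult.assoc flip: gb)
    finally show ?thesis .
  qed
  have inj: "X r \<noteq> X r'" if "r \<noteq> r'" for r r' using that k0 by (simp add: X_def)
  \<comment> \<open>\<open>X r\<close> and \<open>X r'\<close> commute and have the same square, so
    their sum times their difference vanishes.\<close>
  have opp: "X r = - X r'" if r: "r \<in> T" "r' \<in> T" "X r \<noteq> 0" "X r' \<noteq> 0" "r \<noteq> r'" for r r'
  proof -
    have "r' \<in> centralizer {X r}" "\<zeta> \<in> centralizer {X r}" "t \<in> centralizer {X r}" "s \<in> centralizer {X r}" "k \<in> centralizer {X r}"
    proof -
      have *: "\<zeta> * X r = X r * \<zeta>" using centralizerD[OF X[OF r(1)] z(2)] by simp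
      then show "\<zeta> \<in> centralizer {X r}" "k \<in> centralizer {X r}"
        by (auto simp: centralizer_singleton k_def algebra_simps)
      show "r' \<in> centralizer {X r}" "t \<in> centralizer {X r}" "s \<in> centralizer {X r}"
        using centralizerD[OF XT[OF r(1)]] r(2) ts by (simp_all add: centralizer_singleton)
    qed
    then have "X r' \<in> centralizer {X r}" unfolding X_def[of r'] by (intro centralizer_closed)
    then have "(X r - X r') * (X r + X r') = X r * X r - X r' * X r'"
      by (simp add: centralizer_singleton algebra_simps)
    then have "(X r - X r') * (X r + X r') = 0" using sq r by simp
    then show ?thesis using inj[OF r(5)] by (simp add: eq_neg_iff_add_eq_0)
  qed
  \<comment> \<open>As \<open>X\<close> is injective, it vanishes at most once. Among three nonzero
    values that are pairwise opposite, two would coincide.\<close>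
  have "3 \<le> card {r \<in> T. X r \<noteq> 0}"
  proof -
    have fin: "finite T" using card_T by (metis card.infinite not_numeral_le_zero)
    have "card {r \<in> T. X r = 0} \<le> 1" 
      using fin inj by (subst card_le_Suc0_iff_eq[unfolded One_nat_def[symmetric]]) (auto, metis)
    moreover have "card T = card {r \<in> T. X r \<noteq> 0} + card {r \<in> T. X r = 0}"
      using fin by (subst card_Un_disjoint[symmetric]) (auto intro: arg_cong[where f=card])
    ultimately show ?thesis using card_T by simp
  qed
  then obtain r1 r2 r3 where "r1 \<in> T" "r2 \<in> T" "r3 \<in> T" "X r1 \<noteq> 0" "X r2 \<noteq> 0" "X r3 \<noteq> 0" "r1 \<noteq> r2" "r1 \<noteq> r3" "r2 \<noteq> r3"
    by (rule obtain_three) auto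
  then show False using opp[of r1 r2] opp[of r1 r3] inj[of r2 r3] by simp
qed

text \<open>Hua's identity with base point \<open>x + i\<close> and shift \<open>l - i\<close>,
  multiplied by \<open>v\<close>, expresses \<open>(X + (l - i)) * inverse (w * v - 1)\<close>
  through \<open>wt l\<close>. Subtracting the cases \<open>l = j\<close> and \<open>l = k\<close>
  eliminates \<open>X\<close>, and with it \<open>x\<close>.\<close>

lemma wt_relation:
  assumes ijk: "i \<in> T" "j \<in> T" "k \<in> T" "j \<noteq> i" "k \<noteq> i"
  defines "v \<equiv> inverse (wt i)"
  shows "((j - i) - (k - i)) * inverse (w * v - 1) =
    (j - i) * inverse (wt j * v - 1) - (k - i) * inverse (wt k * v - 1)"
proof -
  have v: "wt i \<noteq> 0" "wt i * v = 1" "v \<in> B"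
    using nonzero[OF wt_in[OF ijk(1)]] inverse_in[OF wt_in[OF ijk(1)]] by (simp_all add: v_def)
  have a: "w * v \<noteq> 1"
  proof
    assume "w * v = 1"
    then have "w * v * wt i = wt i" by simp
    then show False using v(1) wt_neq[OF ijk(1)] by (simp add: v_def mult.assoc)
  qed
  define X where "X = wt i * (x + i) * v"
  have one: "(X + (l - i)) * inverse (w * v - 1) = (l - i) * inverse (wt l * v - 1)" if l: "l \<in> T" "l \<noteq> i" for l
  proof -
    have li: "(l - i) * b = b * (l - i)" if "b \<in> B" for b
      using T_commute[OF l(1) that] T_commute[OF ijk(1) that] by (simp add: algebra_simps)
    have "(wt l - wt i) * (x + i) = (l - i) * (w - wt l)"
    proof (rule conj_shift_identity[OF wt_eq[OF ijk(1)]])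
      show "wt l * (x + i + (l - i)) = (x + i + (l - i)) * w" using wt_eq[OF l(1)] by simp
      show "(l - i) * wt l = wt l * (l - i)" by (rule li[OF wt_in[OF l(1)]])
    qed
    then have "(wt l - wt i) * (x + i) * v = (l - i) * (w - wt l) * v" by simp
    moreover have "(wt l * v - 1) * X = (wt l - wt i) * (x + i) * v"
      using v(1) by (simp add: X_def v_def left_diff_distrib mult.assoc inverse_cancel)
    moreover have "(l - i) * (w - wt l) * v = (l - i) * (w * v - 1) - (l - i) * (wt l * v - 1)"
      by (simp only: mult.assoc left_diff_distrib right_diff_distrib)
        (simp add: algebra_simps)
    moreover have "(l - i) * (wt l * v - 1) = (wt l * v - 1) * (l - i)"
      using li[OF mult_in[OF wt_in[OF l(1)] v(3)]] by (simp add: algebra_simps)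
    ultimately have "(wt l * v - 1) * (X + (l - i)) = (l - i) * (w * v - 1)"
      by (simp add: distrib_left)
    moreover have n: "wt l * v - 1 \<noteq> 0"
    proof
      assume "wt l * v - 1 = 0"
      then have "wt l * v * wt i = wt i" by simp
      then have "wt l = wt i" using v(1) by (simp add: v_def mult.assoc)
      then show False using wt_inequiv[OF l(1) ijk(1) l(2)] wt_in[OF ijk(1)] by simp
    qed
    ultimately have "X + (l - i) = inverse (wt l * v - 1) * ((l - i) * (w * v - 1))"
      using inverse_cancel(1)[OF n] by metis
    then have "(X + (l - i)) * inverse (w * v - 1) = inverse (wt l * v - 1) * (l - i)"
      using a by (simp add: mult.assoc)
    also have "\<dots> = (l - i) * inverse (wt l * v - 1)"
      by (rule commute_inverse) (simp add: \<open>(l - i) * (wt l * v - 1) = _\<close>)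
    finally show ?thesis .
  qed
  have "((j - i) - (k - i)) * inverse (w * v - 1) = (X + (j - i)) * inverse (w * v - 1) - (X + (k - i)) * inverse (w * v - 1)"
    by (simp add: algebra_simps)
  then show ?thesis using one ijk by simp
qed

text \<open>With \<open>i\<close> as base point, \<open>wt_relation\<close> gives the relation of
  the two earlier lemmas for any two of \<open>j\<close>, \<open>k\<close>, \<open>l\<close>. If
  \<open>a\<close> failed to commute with one of the three \<open>p s\<close>, the other two would
  both lie in the coset of \<open>inverse (p s)\<close>, although their cosets differ. So
  \<open>a\<close> commutes with \<open>p j\<close> and \<open>p k\<close>, and
  \<open>commuting_relation_False\<close> applies.\<close>

lemma no_noncommuting_shifts: False
proof -
  have fin: "finite T" using card_T by (metis card.infinite not_numeral_le_zero)
  \<comment> \<open>By \<open>wt_inequiv\<close> this discards at most one element of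
    \<open>T\<close>.\<close>
  define T' where "T' = {t \<in> T. \<not> eqv (wt t) w}"
  have "card {t \<in> T. eqv (wt t) w} \<le> 1"
  proof -
    have "t = s" if "t \<in> T" "s \<in> T" "eqv (wt t) w" "eqv (wt s) w" for t s
      using that wt_inequiv[of t s] eqv_trans[of "wt s" w "wt t"] eqv_sym wt_in w by blast
    then show ?thesis using fin
      by (subst card_le_Suc0_iff_eq[unfolded One_nat_def[symmetric]]) auto
  qed
  moreover have "card T = card T' + card {t \<in> T. eqv (wt t) w}"
    using fin unfolding T'_def by (subst card_Un_disjoint[symmetric]) (auto intro: arg_cong[where f=card])
  ultimately have T'4: "4 \<le> card T'" using card_T by simp
  then obtain i where i: "i \<in> T'" by fastforce
  have "3 \<le> card (T' - {i})" using T'4 i by simp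
  then obtain j k l where jkl: "j \<in> T' - {i}" "k \<in> T' - {i}" "l \<in> T' - {i}" "j \<noteq> k" "j \<noteq> l" "k \<noteq> l"
    by (rule obtain_three)
  define v where "v = inverse (wt i)"
  define a where "a = w * v"
  define p where "p t = wt t * v" for t
  have iT: "i \<in> T" "\<not> eqv (wt i) w" using i by (auto simp: T'_def)
  have v: "v \<in> B" "wt i * v = 1" using inverse_in[OF wt_in[OF iT(1)]] nonzero[OF wt_in[OF iT(1)]]
    by (simp_all add: v_def)
  have aB: "a \<in> B" using mult_in w v by (simp add: a_def)
  have a1: "\<not> eqv a 1"
    using eqv_mult_right_iff[OF w wt_in[OF iT(1)] v(1)] iT eqv_sym[OF w wt_in[OF iT(1)]] by (simp add: a_def v)
  have T'D: "t \<in> T" "\<not> eqv (wt t) w" "t \<noteq> i" "p t \<in> B" "\<not> eqv (p t) 1" "\<not> eqv a (p t)" "t - i \<in> centralizer B"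
    if "t \<in> T' - {i}" for t
  proof -
    show t: "t \<in> T" "\<not> eqv (wt t) w" "t \<noteq> i" using that by (auto simp: T'_def)
    show "p t \<in> B" using mult_in wt_in t v by (simp add: p_def)
    show "\<not> eqv (p t) 1"
      using eqv_mult_right_iff[OF wt_in[OF t(1)] wt_in[OF iT(1)] v(1)] wt_inequiv[OF iT(1) t(1)] t(3)
      by (simp add: p_def v)
    show "\<not> eqv a (p t)"
      using eqv_mult_right_iff[OF w wt_in[OF t(1)] v(1)] t(2) eqv_sym[OF w wt_in[OF t(1)]]
      by (simp add: p_def a_def)
    show "t - i \<in> centralizer B" using t(1) iT(1) T_central by (intro centralizer_closed) auto
  qed
  have pne: "\<not> eqv (p s) (p t)" if "s \<in> T' - {i}" "t \<in> T' - {i}" "s \<noteq> t" for s t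
    using eqv_mult_right_iff[OF wt_in wt_in v(1), of s t] wt_inequiv[of t s] that
    by (simp add: p_def T'D(1))
  have rel: "((s - i) - (t - i)) * inverse (a - 1) = (s - i) * inverse (p s - 1) - (t - i) * inverse (p t - 1)"
    if "s \<in> T' - {i}" "t \<in> T' - {i}" for s t
    using wt_relation[OF iT(1) T'D(1)[OF that(1)] T'D(1)[OF that(2)] T'D(3)[OF that(1)] T'D(3)[OF that(2)]]
    by (simp add: a_def p_def v_def)
  have ts: "(s - i) * (t - i) = (t - i) * (s - i)" if "s \<in> T" "t \<in> T" for s t
  proof -
    have "s * t = t * s" "s * i = i * s" "t * i = i * t" using T_abelian that iT by (auto simp: abelian_set_def)
    then show ?thesis by (simp add: algebra_simps)
  qed
  have eqv_inv: "eqv (p t) (inverse (p s))"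
    if "s \<in> T' - {i}" "t \<in> T' - {i}" "s \<noteq> t" "a * p s \<noteq> p s * a" for s t
    using T'D[OF that(1)] T'D[OF that(2)] pne[OF that(1-3)] rel[OF that(1,2)] that(4) ts aB
    by (intro noncommuting_relation_eqv[where a = a and t = "s - i" and s = "t - i"]) auto
  have comm: "a * p s = p s * a" if s: "s \<in> T' - {i}" and t: "t \<in> T' - {i}" "t' \<in> T' - {i}"
    and d: "s \<noteq> t" "s \<noteq> t'" "t \<noteq> t'" for s t t'
  proof (rule ccontr)
    assume n: "a * p s \<noteq> p s * a"
    have "eqv (p t) (p t')"
      using eqv_inv[OF s t(1) d(1) n] eqv_inv[OF s t(2) d(2) n] eqv_trans eqv_sym
        T'D(4)[OF s] T'D(4)[OF t(1)] T'D(4)[OF t(2)] inverse_in by metis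
    then show False using pne[OF t d(3)] by simp
  qed
  have "a * p j = p j * a" using comm[of j k l] jkl by blast
  moreover have "a * p k = p k * a" using comm[of k j l] jkl by blast
  ultimately show False
    using commuting_relation_False[OF aB T'D(4)[OF jkl(1)] T'D(4)[OF jkl(2)] a1 T'D(5)[OF jkl(1)] T'D(5)[OF jkl(2)]
      T'D(6)[OF jkl(1)] T'D(6)[OF jkl(2)] pne[OF jkl(1,2,4)] T'D(7)[OF jkl(1)] T'D(7)[OF jkl(2)] _ _ rel[OF jkl(1,2)]]
      T'D(3)[OF jkl(1)] T'D(3)[OF jkl(2)] by simp
qed

end

section \<open>Commutativity of locally solvable division rings\<close>

text \<open>Sorting the product moves letters \<open>v\<close> past letters \<open>u\<close> three
  times in all, and the factor \<open>c * c * c\<close> disappears.\<close>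

lemma cube_mult:
  fixes c u v :: "'a::monoid_mult"
  assumes "v * u = c * (u * v)" "u * c = c * u" "v * c = c * v" "c * c * c = 1"
  shows "(u * v) * (u * v) * (u * v) = (u * u * u) * (v * v * v)"
proof -
  have "v * (u * y) = c * (u * (v * y))" for y using assms(1) by (metis mult.assoc)
  moreover have "c * (c * (c * y)) = y" for y using assms(4) by (metis mult.assoc mult_1_left)
  ultimately show ?thesis
    by (simp add: mult.assoc assms(1-3) left_commute[OF assms(2)] left_commute[OF assms(3)])
qed

lemma division_subring_Int:
  "division_subring R \<Longrightarrow> division_subring S \<Longrightarrow> division_subring (R \<inter> S)"
  by (auto simp: division_subring_def)

text \<open>With at most four elements, the intersection \<open>Z\<close> is
  \<open>{0, 1, - 1}\<close> if \<open>z = - 1\<close> and \<open>{0, 1, z, z + 1}\<close>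
  otherwise. In the first case the squares of \<open>u\<close> and \<open>v\<close> lie in
  \<open>Z\<close>, in the second their cubes do.\<close>

lemma card_center_of_quantum_plane:
  fixes W :: "'a::division_ring set"
  assumes W: "division_subring W" and uv: "u \<in> W" "v \<in> W" "u * v \<noteq> v * u"
    and z: "u * v = z * (v * u)" "z \<in> W" "z \<in> centralizer {u, v}"
    and fin: "finite (W \<inter> centralizer {u, v})"
  shows "5 \<le> card (W \<inter> centralizer {u, v})"
proof (rule ccontr)
  define Z where "Z = W \<inter> centralizer {u, v}"
  assume "\<not> ?thesis"
  then have card: "card Z \<le> 4" by (simp add: Z_def)
  have fin: "finite Z" using fin by (simp add: Z_def)
  have "division_subring Z"
    unfolding Z_def using W division_subring_centralizer by (rule division_subring_Int)
  note Zcl = division_subringD[OF this]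
  have zZ: "z \<in> Z" using z by (simp add: Z_def)
  have z1: "z \<noteq> 1" using z(1) uv(3) by auto
  have n0: "u \<noteq> 0" "v \<noteq> 0" using uv(3) by auto
  then have "z \<noteq> 0" using z(1) by auto
  note n0 = n0 this
  have zu: "u * z = z * u" "v * z = z * v" using z(3) by (auto simp: centralizer_def)
  have Zu: "a * u = u * a" "a * v = v * a" if "a \<in> Z" for a using that by (auto simp: Z_def centralizer_def)
  have ZI: "a \<in> Z" if "a \<in> W" "a * u = u * a" "a * v = v * a" for a
    using that by (auto simp: Z_def centralizer_def)
  have full: "A = Z" if "A \<subseteq> Z" "4 \<le> card A" for A
    using that card fin by (simp add: card_seteq)
  have small: "\<not> 5 \<le> card A" if "A \<subseteq> Z" for A
    using card_mono[OF fin that] card by simp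
  show False
  proof (cases "z = - 1")
    case True
    then have m1: "(1::'a) \<noteq> - 1" using z1 by auto
    then have m2: "(2::'a) \<noteq> 0" by (metis eq_neg_iff_add_eq_0 one_add_one)
    \<comment> \<open>A further element \<open>a\<close> would bring \<open>- a\<close> with it,
      making five.\<close>
    have Z3: "a \<in> {0, 1, - 1}" if a: "a \<in> Z" for a
    proof (rule ccontr)
      assume na: "a \<notin> {0, 1, - 1}"
      have "a \<noteq> - a"
      proof
        assume "a = - a"
        then have "2 * a = 0" by (simp add: mult_2 eq_neg_iff_add_eq_0)
        then show False using na m2 by simp
      qed
      moreover have "- a \<noteq> 1" using na by (metis insertCI minus_minus)
      ultimately have "card {0, 1, - 1, a, - a} = 5" using na m1 by auto
      moreover have "{0, 1, - 1, a, - a} \<subseteq> Z" using a Zcl by auto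
      ultimately show False using small[of "{0, 1, - 1, a, - a}"] by simp
    qed
    have "(1::'a) + 1 \<in> {0, 1, - 1}" using Z3 Zcl(2,3) by blast
    moreover have "(1::'a) + 1 \<noteq> 1" by (metis add_cancel_right_right zero_neq_one)
    ultimately have three: "(1::'a) + 1 = - 1" using m2 by auto
    have uv': "u * v = - (v * u)" using z(1) True by simp
    have vu: "v * (u * y) = - (u * (v * y))" for y using uv' by (metis minus_minus minus_mult_left mult.assoc)
    have vu0: "v * u = - (u * v)" using uv' by simp
    have sq: "e * e = - 1" if "e \<in> {u, v}" for e
    proof -
      have "e * e \<in> Z"
      proof (rule ZI)
        show "e * e \<in> W" using that uv division_subringD(4)[OF W] by auto
        show "e * e * u = u * (e * e)" "e * e * v = v * (e * e)"
          using that by (auto simp: mult.assoc vu vu0)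
      qed
      then have "e * e \<in> {0, 1, - 1}" by (rule Z3)
      moreover have "e * e \<noteq> 1"
      proof
        assume "e * e = 1"
        then have "e = 1 \<or> e = - 1" by (rule eq_one_or_minus_one)
        then show False using that uv(3) by auto
      qed
      ultimately show ?thesis using that n0 by auto
    qed
    \<comment> \<open>In characteristic three this product is zero, so one of its factors vanishes
      and \<open>u + v\<close> commutes with \<open>v\<close>.\<close>
    have "(1 + (u + v)) * (1 - (u + v)) = 1 - (u * u + v * v) - (u * v + v * u)"
      by (simp add: algebra_simps)
    also have "\<dots> = 1 + (1 + 1)" using sq[of u] sq[of v] by (simp add: uv')
    also have "\<dots> = 0" unfolding three by simp
    finally have "u + v = - 1 \<or> u + v = 1" by (auto simp: add_eq_0_iff)
    then have "v * (u + v) = (u + v) * v" by auto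
    then show False using uv(3) by (simp add: distrib_left distrib_right)
  next
    case False
    have "z + 1 \<noteq> 0" using False by (simp add: eq_neg_iff_add_eq_0)
    then have "card {0, 1, z, z + 1} = 4" using z1 n0 by auto
    moreover have "{0, 1, z, z + 1} \<subseteq> Z" using Zcl zZ by auto
    ultimately have Z4: "Z = {0, 1, z, z + 1}" using full[of "{0, 1, z, z + 1}"] by simp
    have "z * z \<noteq> 1" using z1 False by (auto dest!: eq_one_or_minus_one)
    moreover have "z * z \<in> {0, 1, z, z + 1}" using Zcl(4)[OF zZ zZ] Z4 by simp
    ultimately have zz: "z * z = z + 1" using z1 n0 by auto
    have two: "(2::'a) = 0"
    proof -
      have "1 + 1 \<in> {0, 1, z, z + 1}" using Zcl(3)[OF Zcl(2,2)] Z4 by simp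
      moreover have "1 + 1 \<noteq> z"
      proof
        assume "1 + 1 = z"
        then have "(3::'a) + 1 = 3 + 0" using zz by auto
        then show False by (simp only: add_left_cancel one_neq_zero)
      qed
      moreover have "(1::'a) + 1 \<noteq> 1" by (metis add_cancel_right_right zero_neq_one)
      moreover have "1 + 1 \<noteq> z + 1" using z1 by (simp only: add_right_cancel) simp
      ultimately show ?thesis by simp
    qed
    have dbl: "a + a = 0" for a :: 'a
      using mult_2[of a] two by simp
    then have neg: "- a = a" for a :: 'a by (metis add_eq_0_iff)
    have dbl': "a + (a + b) = b" for a b :: 'a using dbl[of a] by (simp flip: add.assoc)
    have zzz: "z * z * z = 1" "z * (z * z) = 1" by (simp_all add: zz algebra_simps dbl dbl')
    have zz': "z * (z * y) = z * y + y" for y using zz by (metis distrib_right mult.assoc mult_1_left)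
    have gen3: "a * a * a = 1" if "a \<in> {z, z + 1}" for a
      using that by (auto simp: algebra_simps zz dbl dbl' two)
    have gen2: "a * b = 1" if "a \<in> {z, z + 1}" "b \<in> {z, z + 1}" "a \<noteq> b" for a b
      using that by (auto simp: algebra_simps zz dbl dbl' two)
    \<comment> \<open>In characteristic two, \<open>e * e * e + 1\<close> splits into the factors
      \<open>e + 1\<close>, \<open>e + z\<close> and \<open>e + (z + 1)\<close>.\<close>
    have root: "e \<in> Z" if "e * e * e = 1" "e * z = z * e" for e
    proof -
      have "(e + 1) * ((e + z) * (e + (z + 1))) = e * e * e + 1"
        by (simp add: algebra_simps that(2) left_commute[OF that(2)] zz zz' dbl dbl' two)
      then have "e + 1 = 0 \<or> e + z = 0 \<or> e + (z + 1) = 0" using that(1) two by auto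
      then have "e = 1 \<or> e = z \<or> e = z + 1" by (metis add_eq_0_iff2 neg)
      then show ?thesis using Z4 by auto
    qed
    have vu: "v * u = z * z * (u * v)" using z(1) zzz by (simp flip: mult.assoc)
    have vu': "v * (u * y) = z * (z * (u * (v * y)))" for y using vu by (metis mult.assoc)
    have z3: "z * (z * (z * y)) = y" for y using zzz(1) by (metis mult.assoc mult_1_left)
    note norm = mult.assoc vu vu' zu left_commute[OF zu(1)] left_commute[OF zu(2)] z3
    have cube: "e * e * e \<in> {z, z + 1}" if "e \<in> {u, v}" for e
    proof -
      have "e * e * e \<in> Z"
      proof (rule ZI)
        show "e * e * e \<in> W" using that uv division_subringD(4)[OF W] by auto
        show "e * e * e * u = u * (e * e * e)" "e * e * e * v = v * (e * e * e)"
          using that by (auto simp: norm)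
      qed
      moreover have "e * e * e \<noteq> 1"
      proof
        assume "e * e * e = 1"
        then have "e \<in> Z" using root zu that by auto
        then show False using Zu that uv by auto
      qed
      ultimately show ?thesis using that n0 Z4 by auto
    qed
    show False
    \<comment> \<open>The two cubes are taken from the mutually inverse elements \<open>z\<close>
      and \<open>z + 1\<close>. If they agree, \<open>u * (v * v)\<close> has cube 1, otherwise
      \<open>u * v\<close> does; either would lie in \<open>Z\<close> without commuting with
      \<open>u\<close>.\<close>
    proof (cases "u * u * u = v * v * v")
      case True
      have "(u * (v * v)) * (u * (v * v)) * (u * (v * v)) = (u * u * u) * ((v * v) * (v * v) * (v * v))"
        by (rule cube_mult[where c = z]) (simp_all add: norm zzz)
      also have "\<dots> = (v * v * v) * (v * v * v) * (v * v * v)" unfolding True by (simp only: mult.assoc)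
      also have "\<dots> = 1" by (rule gen3) (use cube in auto)
      finally have "u * (v * v) \<in> Z" by (rule root) (simp add: norm)
      then have "u * (v * v) * u = u * (u * (v * v))" by (rule Zu)
      moreover have "u * (v * v) * u = z * (u * (u * (v * v)))" by (simp add: norm)
      ultimately show False using n0 z1 by simp
    next
      case False
      then have one: "(u * u * u) * (v * v * v) = 1"
        using gen2[OF cube[of u] cube[of v]] by simp
      have "(u * v) * (u * v) * (u * v) = (u * u * u) * (v * v * v)"
        by (rule cube_mult[where c = "z * z"]) (simp_all add: norm zzz)
      then have "(u * v) * (u * v) * (u * v) = 1" unfolding one .
      then have "u * v \<in> Z" by (rule root) (simp add: norm)
      then have "u * v * u = u * (u * v)" by (rule Zu)
      then have "u * (v * u) = u * (u * v)" by (simp add: mult.assoc)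
      then show False using n0 uv by simp
    qed
  qed
qed

text \<open>The hypothesis isolates what solvability provides. It can thus be met both by a division
  subring with units inside \<open>M\<close> and by \<open>D\<close> itself when its units are
  products of elements of \<open>M\<close> and central elements.\<close>

lemma abelian_set_of_class_two:
  fixes H :: "'a::division_ring set"
  assumes H: "division_subring H"
    and ex: "\<And>S. finite S \<Longrightarrow> S \<subseteq> H - {0} \<Longrightarrow> \<not> abelian_set S \<Longrightarrow>
      \<exists>N \<subseteq> H. class_two N \<and> N \<subseteq> centralizer (centralizer S) \<and> (\<forall>s\<in>S. normalizes s N) \<and>
        \<not> N \<subseteq> centralizer S"
  shows "abelian_set H"
proof (rule ccontr)
  assume "\<not> abelian_set H"
  then obtain x y where xy: "x \<in> H" "y \<in> H" "x * y \<noteq> y * x" by (auto simp: abelian_set_def)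
  note Hcl = division_subringD[OF H]
  obtain u v z where uv: "u \<in> H" "v \<in> H" "u * v \<noteq> v * u" "z \<in> H" "z \<in> centralizer {u, v}"
    and z: "z = u * v * inverse u * inverse v" "u * v = z * (v * u)"
  proof -
    \<comment> \<open>The translates by 1 are included so that Hua's identity excludes an abelian
      \<open>N\<close>.\<close>
    let ?S = "{x, x + 1, y, y + 1}"
    have "x + 1 \<noteq> 0" "y + 1 \<noteq> 0" using xy by (auto simp: add_eq_0_iff2)
    then have "?S \<subseteq> H - {0}" using xy Hcl by auto
    moreover have "\<not> abelian_set ?S" using xy(3) by (auto simp: abelian_set_def)
    ultimately obtain N where N: "N \<subseteq> H" "class_two N" "\<forall>s\<in>?S. normalizes s N" "\<not> N \<subseteq> centralizer ?S"
      using ex[of ?S] by auto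
    interpret class_two N by fact
    have "\<not> abelian_set N"
    proof
      assume ab: "abelian_set N"
      have "e * n = n * e" if "n \<in> N" "normalizes e N" "normalizes (e + 1) N" for e n
      proof (rule commute_abelian_of_shift[OF ab that(1), where t = 1])
        show "e * n * inverse e \<in> N" "(e + 1) * n * inverse (e + 1) \<in> N"
          using that unfolding normalizes_def by blast+
      qed simp_all
      then have "x * n = n * x" "y * n = n * y" if "n \<in> N" for n using N(3) that by auto
      then have "N \<subseteq> centralizer ?S" by (auto simp: centralizer_def algebra_simps)
      then show False using N(4) by simp
    qed
    then obtain u v where uv: "u \<in> N" "v \<in> N" "u * v \<noteq> v * u" by (auto simp: abelian_set_def)
    have "u * v = u * v * inverse u * inverse v * (v * u)"
      using nonzero uv by (simp add: mult.assoc inverse_cancel)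
    moreover have "u * v * inverse u * inverse v \<in> centralizer {u, v}"
      using commutator_central[OF uv(1,2)] uv unfolding centralizer_def by blast
    moreover have "u * v * inverse u * inverse v \<in> H" using uv N(1) by (intro Hcl) auto
    ultimately show thesis using that uv N(1) by blast
  qed
  \<comment> \<open>The double centralizer stands in for the division ring generated by
    \<open>u\<close> and \<open>v\<close>: whatever commutes with \<open>u\<close> and
    \<open>v\<close> commutes with all of \<open>W\<close>. This makes \<open>T\<close> below
    commutative.\<close>
  define W where "W = H \<inter> centralizer (centralizer {u, v})"
  have W: "division_subring W" unfolding W_def using H division_subring_centralizer by (rule division_subring_Int)
  have "u \<in> centralizer (centralizer {u, v})" "v \<in> centralizer (centralizer {u, v})"
    by (auto simp: centralizer_def)
  then have uvW: "u \<in> W" "v \<in> W" using uv by (auto simp: W_def)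
  then have "z \<in> W" unfolding z(1) using division_subringD[OF W] by simp
  let ?Z = "W \<inter> centralizer {u, v}"
  have "\<exists>T \<subseteq> ?Z. card T = 5"
  proof (cases "finite ?Z")
    case True
    then show ?thesis
      using card_center_of_quantum_plane[OF W uvW uv(3) z(2) \<open>z \<in> W\<close> uv(5)] obtain_subset_with_card_n by metis
  next
    case False
    then show ?thesis using infinite_arbitrarily_large[of ?Z 5] by blast
  qed
  then obtain T where T: "T \<subseteq> ?Z" "card T = 5" by blast
  have Tuv: "t * u = u * t" "t * v = v * t" if "t \<in> T" for t using T(1) that by (auto simp: centralizer_def)
  have Tab: "abelian_set T" using T(1) by (auto simp: abelian_set_def W_def centralizer_def)
  have TH: "T \<subseteq> H" using T(1) by (auto simp: W_def)
  \<comment> \<open>\<open>T\<close> centralizes \<open>S\<close>, hence also the group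
    \<open>N\<close> found in the double centralizer of \<open>S\<close>.\<close>
  define S where "S = (\<lambda>t. u + t) ` T \<union> (\<lambda>t. v + t) ` T"
  obtain t0 where t0: "t0 \<in> T" using T(2) by fastforce
  have "u + t \<noteq> 0" "v + t \<noteq> 0" if "t \<in> T" for t
    using Tuv[OF that] uv(3) by (auto simp: add_eq_0_iff2)
  then have "S \<subseteq> H - {0}" using TH uv Hcl(3) by (auto simp: S_def)
  moreover have "finite S" 
  proof -
    have "finite T" using T(2) by (metis card.infinite zero_neq_numeral)
    then show ?thesis by (simp add: S_def)
  qed
  moreover have "\<not> abelian_set S"
  proof
    assume "abelian_set S"
    then have "(u + t0) * (v + t0) = (v + t0) * (u + t0)" using t0 by (simp add: abelian_set_def S_def)
    then show False using Tuv[OF t0] uv(3) by (simp add: algebra_simps)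
  qed
  ultimately obtain N where N: "N \<subseteq> H" "class_two N" "N \<subseteq> centralizer (centralizer S)"
      "\<forall>s\<in>S. normalizes s N" "\<not> N \<subseteq> centralizer S"
    using ex[of S] by auto
  interpret class_two N by fact
  have "T \<subseteq> centralizer S"
    using Tuv Tab by (auto simp: S_def centralizer_def abelian_set_def distrib_left distrib_right)
  then have TN: "T \<subseteq> centralizer N" using N(3) unfolding centralizer_def by fastforce
  have comm: "e * n = n * e" if e: "e = u \<or> e = v" and n: "n \<in> N" for e n
  proof (rule ccontr)
    assume "e * n \<noteq> n * e"
    then interpret noncommuting_shifts N e n T
    proof unfold_locales
      show "normalizes (e + t) N" if "t \<in> T" for t using N(4) e that by (auto simp: S_def)
    qed (use TN Tab T(2) n in auto)
    show False by (rule no_noncommuting_shifts)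
  qed
  have "N \<subseteq> centralizer S"
  proof
    fix n assume n: "n \<in> N"
    have "t * n = n * t" if "t \<in> T" for t using TN n that by (auto simp: centralizer_def)
    then show "n \<in> centralizer S"
      using comm[of u n] comm[of v n] n by (auto simp: S_def centralizer_def distrib_left distrib_right)
  qed
  then show False using N(5) by simp
qed

section \<open>Maximal subgroups\<close>

lemma group_units: "group (mgrp units_D)"
proof (rule groupI)
  fix x :: 'a assume "x \<in> carrier (mgrp units_D)"
  then show "\<exists>y\<in>carrier (mgrp units_D). y \<otimes>\<^bsub>mgrp units_D\<^esub> x = \<one>\<^bsub>mgrp units_D\<^esub>"
    by (intro bexI[of _ "inverse x"]) (auto simp: mgrp_def units_D_def)
qed (auto simp: mgrp_def units_D_def mult.assoc)

lemma mgrp_simps [simp]: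
  "carrier (mgrp G) = G" "x \<otimes>\<^bsub>mgrp G\<^esub> y = x * y" "\<one>\<^bsub>mgrp G\<^esub> = 1" "(mgrp G)\<lparr>carrier := K\<rparr> = mgrp K"
  by (simp_all add: mgrp_def)

lemma inv_units: "x \<noteq> 0 \<Longrightarrow> inv\<^bsub>mgrp units_D\<^esub> x = inverse x"
  by (rule group.inv_equality[OF group_units]) (auto simp: units_D_def)

lemma subgroup_units_iff:
  "subgroup G (mgrp units_D) \<longleftrightarrow>
    0 \<notin> G \<and> 1 \<in> G \<and> (\<forall>x\<in>G. \<forall>y\<in>G. x * y \<in> G) \<and> (\<forall>x\<in>G. inverse x \<in> G)"
proof
  assume G: "subgroup G (mgrp units_D)"
  have "0 \<notin> G" using subgroup.subset[OF G] by (auto simp: units_D_def)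
  moreover from this have "inverse x \<in> G" if "x \<in> G" for x
    using subgroup.m_inv_closed[OF G that] that inv_units[of x] by metis
  ultimately show "0 \<notin> G \<and> 1 \<in> G \<and> (\<forall>x\<in>G. \<forall>y\<in>G. x * y \<in> G) \<and> (\<forall>x\<in>G. inverse x \<in> G)"
    using subgroup.one_closed[OF G] subgroup.m_closed[OF G] by simp
next
  assume *: "0 \<notin> G \<and> 1 \<in> G \<and> (\<forall>x\<in>G. \<forall>y\<in>G. x * y \<in> G) \<and> (\<forall>x\<in>G. inverse x \<in> G)"
  have "inv\<^bsub>mgrp units_D\<^esub> x \<in> G" if "x \<in> G" for x
    using * that inv_units[of x] by metis
  then show "subgroup G (mgrp units_D)"
    using * by unfold_locales (auto simp: units_D_def)
qed

lemma inv_subgroup_units: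
  assumes "subgroup G (mgrp units_D)" "x \<in> G"
  shows "inv\<^bsub>mgrp G\<^esub> x = inverse x"
proof -
  have "x \<noteq> 0" using assms by (auto simp: subgroup_units_iff)
  then show ?thesis using group.m_inv_consistent[OF group_units assms] by (simp add: inv_units)
qed

lemma normal_iff:
  assumes G: "subgroup G (mgrp units_D)"
  shows "N \<lhd> mgrp G \<longleftrightarrow>
    subgroup N (mgrp units_D) \<and> N \<subseteq> G \<and> (\<forall>g\<in>G. \<forall>n\<in>N. g * n * inverse g \<in> N)"
proof -
  have gG: "group (mgrp G)" using group.subgroup_imp_group[OF group_units G] by simp
  have "subgroup N (mgrp G) \<longleftrightarrow> subgroup N (mgrp units_D) \<and> N \<subseteq> G"
    using group.incl_subgroup[OF group_units G, of N] group.subgroup_incl[OF group_units, of N G] G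
      subgroup.subset[of N "mgrp G"] by auto
  then show ?thesis
    using group.normal_inv_iff[OF gG, of N] inv_subgroup_units[OF G] by auto
qed

text \<open>\<open>N\<close> is the last term of the derived series that does not centralize
  \<open>S\<close>. The next term contains the commutators of \<open>N\<close> and centralizes
  \<open>S\<close>, hence the whole double centralizer of \<open>S\<close>, where \<open>N\<close>
  lies.\<close>

lemma solvable_class_two:
  fixes S :: "'a::division_ring set"
  assumes S: "0 \<notin> S" and nab: "\<not> abelian_set S"
    and solv: "solvable (mgrp (generate (mgrp units_D) S))"
  shows "\<exists>N \<subseteq> generate (mgrp units_D) S. class_two N \<and> N \<subseteq> centralizer (centralizer S) \<and>
    (\<forall>s\<in>S. normalizes s N) \<and> \<not> N \<subseteq> centralizer S"
proof -
  define G where "G = generate (mgrp units_D) S"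
  have SU: "S \<subseteq> carrier (mgrp units_D)" using S by (auto simp: units_D_def)
  have G: "subgroup G (mgrp units_D)" unfolding G_def by (rule group.generate_is_subgroup[OF group_units SU])
  have SG: "S \<subseteq> G" unfolding G_def by (auto intro: generate.incl)
  interpret G: group "mgrp G" using group.subgroup_imp_group[OF group_units G] by simp
  have GCC: "G \<subseteq> centralizer (centralizer S)"
  proof -
    let ?C = "centralizer (centralizer S) - {0}"
    have "subgroup ?C (mgrp units_D)"
      unfolding subgroup_units_iff by (auto intro: centralizer_closed)
    moreover have "S \<subseteq> ?C" using S by (auto simp: centralizer_def)
    ultimately have "G \<subseteq> ?C"
      unfolding G_def by (intro group.generate_subgroup_incl[OF group_units])
    then show ?thesis by auto
  qed
  define E where "E i = (derived (mgrp G) ^^ i) G" for i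
  have Enorm: "E i \<lhd> mgrp G" for i
  proof (induction i)
    case 0
    show ?case using G.normal_self by (simp add: E_def)
  next
    case (Suc i)
    then show ?case using G.derived_is_normal by (simp add: E_def)
  qed
  obtain n where "E n = {1}"
    using G.solvable_imp_trivial_derived_seq[of G] solv by (auto simp: solvable_def E_def G_def)
  then have "E n \<subseteq> centralizer S" by (auto simp: centralizer_def)
  moreover have "\<not> E 0 \<subseteq> centralizer S"
  proof
    assume "E 0 \<subseteq> centralizer S"
    then have "S \<subseteq> centralizer S" using SG by (auto simp: E_def)
    then show False using nab centralizerD unfolding abelian_set_def by blast
  qed
  ultimately obtain i where i: "\<not> E i \<subseteq> centralizer S" "E (Suc i) \<subseteq> centralizer S"
    by (induction n) auto
  have N: "subgroup (E i) (mgrp units_D)" "E i \<subseteq> G" "\<And>g n. g \<in> G \<Longrightarrow> n \<in> E i \<Longrightarrow> g * n * inverse g \<in> E i"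
    using Enorm[of i] normal_iff[OF G] by auto
  note NU = N(1)[unfolded subgroup_units_iff]
  have CS: "centralizer S \<subseteq> centralizer (E i)"
    using GCC N(2) unfolding centralizer_def by fastforce
  have "class_two (E i)"
  proof
    fix a b assume ab: "a \<in> E i" "b \<in> E i"
    have "a * b * inverse a * inverse b \<in> derived_set (mgrp G) (E i)"
      using ab N(2) inv_subgroup_units[OF G] by (auto simp: subset_iff)
    then have "a * b * inverse a * inverse b \<in> E (Suc i)"
      unfolding E_def funpow.simps o_apply derived_def by (rule generate.incl)
    then show "a * b * inverse a * inverse b \<in> centralizer (E i)" using i(2) CS by auto
  qed (use NU in auto)
  moreover have "normalizes s (E i)" if s: "s \<in> S" for s
  proof -
    have s': "s \<in> G" "inverse s \<in> G" "s \<noteq> 0" using s SG G S by (auto simp: subgroup_units_iff)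
    have "n \<in> (\<lambda>b. s * b * inverse s) ` E i" if "n \<in> E i" for n
    proof
      show "n = s * (inverse s * n * s) * inverse s" using s'(3) by (simp add: mult.assoc inverse_cancel)
      show "inverse s * n * s \<in> E i" using N(3)[OF s'(2) that] s'(3) by simp
    qed
    then show ?thesis using N(3)[OF s'(1)] s'(3) by (auto simp: normalizes_def)
  qed
  ultimately show ?thesis using N(2) GCC i(1) unfolding G_def[symmetric] by blast
qed

text \<open>The products of elements of \<open>M\<close> and nonzero elements of \<open>L\<close>
  form a subgroup containing \<open>M\<close>. If it is not \<open>M\<close>, it consists of all
  units; these then normalize \<open>L\<close>, and Cartan-Brauer-Hua applies.\<close>

lemma maximal_subgroup_dichotomy:
  fixes L M :: "'a::division_ring set"
  assumes M: "maximal_subgroup_units M" and L: "division_subring L"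
    and norm: "\<And>m l. m \<in> M \<Longrightarrow> l \<in> L \<Longrightarrow> m * l * inverse m \<in> L"
  shows "L - {0} \<subseteq> M \<or> (\<forall>d. d \<noteq> 0 \<longrightarrow> (\<exists>m\<in>M. \<exists>l\<in>L - {0}. d = m * l)) \<and> (L = UNIV \<or> L \<subseteq> center_D)"
proof -
  have sM: "subgroup M (mgrp units_D)"
    and max: "\<And>N. subgroup N (mgrp units_D) \<Longrightarrow> M \<subseteq> N \<Longrightarrow> N = M \<or> N = units_D"
    using M by (auto simp: maximal_subgroup_units_def)
  note MU = sM[unfolded subgroup_units_iff]
  note Lcl = division_subringD[OF L]
  have norm': "inverse m * l * m \<in> L" if "m \<in> M" "l \<in> L" for m l
    using norm[of "inverse m" l] MU that by (metis inverse_inverse_eq)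
  define N where "N = {m * l | m l. m \<in> M \<and> l \<in> L - {0}}"
  have NI: "m * l \<in> N" if "m \<in> M" "l \<in> L" "l \<noteq> 0" for m l using that by (auto simp: N_def)
  \<comment> \<open>Moving \<open>m'\<close> to the left past \<open>l\<close> replaces
    \<open>l\<close> by a conjugate, which stays in \<open>L\<close>.\<close>
  have mult: "m * l * (m' * l') = (m * m') * ((inverse m' * l * m') * l')" if "m' \<in> M" for m m' l l'
    using that MU by (metis inverse_cancel(2) mult.assoc)
  have "subgroup N (mgrp units_D)"
    unfolding subgroup_units_iff
  proof (intro conjI ballI)
    show "0 \<notin> N" using MU by (auto simp: N_def)
    show "1 \<in> N" using NI[of 1 1] MU Lcl(2) by simp
    fix a assume "a \<in> N"
    then obtain m l where a: "a = m * l" "m \<in> M" "l \<in> L" "l \<noteq> 0" "m \<noteq> 0" using MU by (auto simp: N_def)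
    have "inverse a = inverse m * (m * inverse l * inverse m)"
      unfolding a(1) using a(4,5) by (simp add: nonzero_inverse_mult_distrib mult.assoc inverse_cancel)
    moreover have "m * inverse l * inverse m \<in> L - {0}"
      using norm[OF a(2) Lcl(6)[OF a(3)]] a(4,5) by simp
    ultimately show "inverse a \<in> N" using MU a(2) unfolding N_def by blast
    fix b assume "b \<in> N"
    then obtain m' l' where b: "b = m' * l'" "m' \<in> M" "l' \<in> L" "l' \<noteq> 0" "m' \<noteq> 0" using MU by (auto simp: N_def)
    have "a * b = (m * m') * ((inverse m' * l * m') * l')" unfolding a(1) b(1) by (rule mult[OF b(2)])
    moreover have "(inverse m' * l * m') * l' \<in> L - {0}" 
      using Lcl(4)[OF norm'[OF b(2) a(3)] b(3)] a(4) b(4,5) by simp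
    ultimately show "a * b \<in> N" using MU a(2) b(2) unfolding N_def by blast
  qed
  moreover have "M \<subseteq> N" using NI[of _ 1] Lcl(2) by auto
  ultimately consider "N = M" | "N = units_D" using max by blast
  then show ?thesis
  proof cases
    case 1
    have "L - {0} \<subseteq> N" using NI[of 1] MU by auto
    then show ?thesis using 1 by simp
  next
    case 2
    have prod: "\<exists>m\<in>M. \<exists>l\<in>L - {0}. d = m * l" if "d \<noteq> 0" for d
    proof -
      have "d \<in> N" using 2 that by (simp add: units_D_def)
      then show ?thesis unfolding N_def by blast
    qed
    have "d * a * inverse d \<in> L" if d: "d \<noteq> 0" and a: "a \<in> L" for d a
    proof -
      obtain m l where ml: "m \<in> M" "l \<in> L" "d = m * l" using prod[OF d] by blast
      have n0: "m \<noteq> 0" "l \<noteq> 0" using d ml(3) by auto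
      have "d * a * inverse d = m * (l * a * inverse l) * inverse m"
        unfolding ml(3) using n0 by (simp add: nonzero_inverse_mult_distrib mult.assoc)
      then show ?thesis using norm[OF ml(1) Lcl(4)[OF Lcl(4)[OF ml(2) a] Lcl(6)[OF ml(2)]]] by simp
    qed
    then have "L = UNIV \<or> L \<subseteq> center_D" using Cartan_Brauer_Hua[OF L] by blast
    then show ?thesis using prod by blast
  qed
qed

text \<open>This preimage under an inner automorphism reduces the invariance of a generated division
  subring to its generators.\<close>

lemma conj_division_subring:
  fixes m :: "'a::division_ring"
  assumes "m \<noteq> 0" "division_subring R"
  shows "division_subring {x. m * x * inverse m \<in> R}"
proof -
  have "m * (x * y) * inverse m = (m * x * inverse m) * (m * y * inverse m)" for x y
    using assms(1) by (simp add: mult.assoc inverse_cancel)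
  moreover have "m * inverse x * inverse m = inverse (m * x * inverse m)" if "x \<noteq> 0" for x
    using assms(1) that by (simp add: nonzero_inverse_mult_distrib mult.assoc)
  ultimately show ?thesis
    using assms unfolding division_subring_def by (auto simp: distrib_left distrib_right)
qed

lemma division_subring_gen_divring: "division_subring (gen_divring S)"
  unfolding gen_divring_def division_subring_def by auto

lemma gen_divring_subset:
  "division_subring R \<Longrightarrow> center_D \<union> S \<subseteq> R \<Longrightarrow> gen_divring S \<subseteq> R"
  unfolding gen_divring_def by blast

lemma gen_divring_superset: "center_D \<union> S \<subseteq> gen_divring S"
  unfolding gen_divring_def by blast

text \<open>Centralizers are division subrings containing the centre. So the generated ring
  centralizes \<open>S\<close>; then \<open>S\<close> centralizes the generated ring, and so does
  the ring itself.\<close>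

lemma abelian_gen_divring:
  assumes "abelian_set S" shows "abelian_set (gen_divring S)"
proof -
  have c: "center_D \<subseteq> centralizer R" for R :: "'a set" by (auto simp: center_D_def centralizer_def)
  have "gen_divring S \<subseteq> centralizer S"
    using assms c by (intro gen_divring_subset division_subring_centralizer)
      (auto simp: abelian_set_def centralizer_def)
  then have "S \<subseteq> centralizer (gen_divring S)" unfolding centralizer_def by fastforce
  then have "gen_divring S \<subseteq> centralizer (gen_divring S)"
    using c by (intro gen_divring_subset division_subring_centralizer) auto
  then show ?thesis unfolding abelian_set_def using centralizerD by blast
qed

lemma conj_center:
  assumes "m \<noteq> 0" "c \<in> center_D" shows "m * c * inverse m = c"
proof -
  have "m * c = c * m" using assms(2) by (simp add: center_D_def)
  then show ?thesis using assms(1) by (simp add: mult.assoc)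
qed

section \<open>The structure of maximal abelian normal subgroups of \<open>M\<close>\<close>

theorem theorem2p2:
  fixes M A :: "'a::division_ring set"
  assumes noncomm: "\<exists>x y :: 'a. x * y \<noteq> y * x"
    and maxM: "maximal_subgroup_units M"
    and nonab: "\<not> abelian_set M"
    and locsolv: "locally_solvable M"
    and maxA: "max_abelian_normal A M"
  shows "A = gen_divring A - {0} \<and>
         (A = center_D - {0} \<or>
          (centralizer A \<inter> M = gen_divring A - {0} \<and>
           gen_divring A - {0} = centralizer (gen_divring A) - {0} \<and>
           maximal_subfield (centralizer (gen_divring A))))"
proof -
  have sM: "subgroup M (mgrp units_D)" using maxM by (simp add: maximal_subgroup_units_def)
  note MU = sM[unfolded subgroup_units_iff]
  \<comment> \<open>Subgroups generated within \<open>M\<close> agree with those generated within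
    all units.\<close>
  have solv: "solvable (mgrp (generate (mgrp units_D) S))" if "finite S" "S \<subseteq> M" for S
    using locsolv that group.generate_consistent[OF group_units that(2) sM]
    unfolding locally_solvable_def mgrp_simps by metis
  have A: "subgroup A (mgrp units_D)" "A \<subseteq> M" "\<And>g a. g \<in> M \<Longrightarrow> a \<in> A \<Longrightarrow> g * a * inverse g \<in> A"
    and Aab: "abelian_set A"
    and Amax: "\<And>B. B \<lhd> mgrp M \<Longrightarrow> abelian_set B \<Longrightarrow> A \<subseteq> B \<Longrightarrow> B = A"
    using maxA normal_iff[OF sM] by (auto simp: max_abelian_normal_def)
  define L where "L = gen_divring A"
  have Lsub: "division_subring L" and AL: "A \<subseteq> L" and FL: "center_D \<subseteq> L" and Lab: "abelian_set L"
    unfolding L_def using division_subring_gen_divring gen_divring_superset abelian_gen_divring[OF Aab] by auto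
  have A0: "0 \<notin> A" using A(2) MU by auto
  have normal_units: "R - {0} \<lhd> mgrp M"
    if "division_subring R" "R - {0} \<subseteq> M" "\<And>m r. m \<in> M \<Longrightarrow> r \<in> R \<Longrightarrow> m * r * inverse m \<in> R" for R
    unfolding normal_iff[OF sM] subgroup_units_iff using that division_subringD[OF that(1)] MU by auto
  have normL: "m * l * inverse m \<in> L" if m: "m \<in> M" and l: "l \<in> L" for m l
  proof -
    have m0: "m \<noteq> 0" using m MU by auto
    have "L \<subseteq> {x. m * x * inverse m \<in> L}"
      unfolding L_def
    proof (rule gen_divring_subset)
      show "division_subring {x. m * x * inverse m \<in> gen_divring A}"
        by (rule conj_division_subring[OF m0 division_subring_gen_divring])
      show "center_D \<union> A \<subseteq> {x. m * x * inverse m \<in> gen_divring A}"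
        using A(3)[OF m] gen_divring_superset[of A] by (auto simp: conj_center[OF m0])
    qed
    then show ?thesis using l by blast
  qed
  \<comment> \<open>Otherwise the commutative ring \<open>L\<close> is central and every unit is an
    element of \<open>M\<close> times a central one; solvability then carries over from
    \<open>M\<close> and makes \<open>D\<close> commutative.\<close>
  have LM: "L - {0} \<subseteq> M"
  proof (rule ccontr)
    assume "\<not> L - {0} \<subseteq> M"
    then have prod: "\<And>d. d \<noteq> 0 \<Longrightarrow> \<exists>m\<in>M. \<exists>l\<in>L - {0}. d = m * l" and "L = UNIV \<or> L \<subseteq> center_D"
      using maximal_subgroup_dichotomy[OF maxM Lsub normL] by blast+
    then have LF: "L \<subseteq> center_D" using Lab noncomm by (auto simp: abelian_set_def)
    have "abelian_set (UNIV :: 'a set)"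
    proof (rule abelian_set_of_class_two)
      fix S :: "'a set" assume S: "finite S" "S \<subseteq> UNIV - {0}" "\<not> abelian_set S"
      have "\<forall>s\<in>S. \<exists>m\<in>M. \<exists>l\<in>center_D - {0}. s = m * l" using prod LF S(2) by blast
      \<comment> \<open>\<open>f s\<close> differs from \<open>s\<close> by a nonzero central
        factor, so it has the same centralizer and induces the same conjugation. A class two group
        built from the image of \<open>S\<close> in \<open>M\<close> therefore also serves
        \<open>S\<close>.\<close>
      then obtain f where f: "\<And>s. s \<in> S \<Longrightarrow> f s \<in> M \<and> (\<exists>l\<in>center_D - {0}. s = f s * l)" by metis
      have f0: "f s \<noteq> 0" if "s \<in> S" for s using f[OF that] MU by auto
      have commf: "s * y = y * s \<longleftrightarrow> f s * y = y * f s" if s: "s \<in> S" for s y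
      proof -
        obtain l where l: "l \<in> center_D" "l \<noteq> 0" "s = f s * l" using f[OF s] by auto
        have c: "l * y = y * l" for y using l(1) by (simp add: center_D_def)
        have "s * y = f s * y * l" using c by (metis l(3) mult.assoc)
        moreover have "y * s = y * f s * l" by (metis l(3) mult.assoc)
        ultimately show ?thesis using l(2) by simp
      qed
      have cent: "centralizer (f ` S) = centralizer S"
        using commf unfolding centralizer_def by (auto; metis)
      have conjf: "s * n * inverse s = f s * n * inverse (f s)" if s: "s \<in> S" for s n
      proof -
        obtain l where l: "l \<in> center_D" "l \<noteq> 0" "s = f s * l" using f[OF s] by auto
        have "s * n * inverse s = f s * (l * n * inverse l) * inverse (f s)"
          using l(2) f0[OF s] by (subst l(3), subst l(3)) (simp add: nonzero_inverse_mult_distrib mult.assoc)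
        also have "l * n * inverse l = n" using l by (simp add: center_D_def mult.assoc)
        finally show ?thesis .
      qed
      have nab: "\<not> abelian_set (f ` S)"
      proof
        assume "abelian_set (f ` S)"
        then have "f ` S \<subseteq> centralizer (f ` S)" by (auto simp: abelian_set_def centralizer_def)
        then have "f s * t = t * f s" if "s \<in> S" "t \<in> S" for s t
          unfolding cent using that by (auto simp: centralizer_def)
        then show False using commf S(3) by (auto simp: abelian_set_def)
      qed
      have "0 \<notin> f ` S" using f0 by auto
      then obtain N where N: "class_two N" "N \<subseteq> centralizer (centralizer (f ` S))" "\<forall>s\<in>f ` S. normalizes s N"
          "\<not> N \<subseteq> centralizer (f ` S)"
        using solvable_class_two[OF _ nab solv] S(1) f by (metis finite_imageI image_subsetI)
      have "\<forall>s\<in>S. normalizes s N" using N(3) S(2) by (auto simp: normalizes_def conjf)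
      then show "\<exists>N\<subseteq>UNIV. class_two N \<and> N \<subseteq> centralizer (centralizer S) \<and> (\<forall>s\<in>S. normalizes s N) \<and>
          \<not> N \<subseteq> centralizer S"
        using N unfolding cent by blast
    qed (auto simp: division_subring_def)
    then show False using noncomm by (auto simp: abelian_set_def)
  qed
  \<comment> \<open>\<open>L - {0}\<close> is now an abelian normal subgroup of \<open>M\<close>
    containing \<open>A\<close>.\<close>
  have AeqL: "A = L - {0}"
  proof -
    have "L - {0} \<lhd> mgrp M" using normal_units[OF Lsub LM normL] .
    moreover have "abelian_set (L - {0})" using Lab by (auto simp: abelian_set_def)
    ultimately show ?thesis using Amax[of "L - {0}"] AL A0 by auto
  qed
  define K where "K = centralizer L"
  have Ksub: "division_subring K" unfolding K_def by (rule division_subring_centralizer)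
  have LK: "L \<subseteq> K" using Lab by (auto simp: K_def abelian_set_def centralizer_def)
  have "A = center_D - {0} \<or> (centralizer A \<inter> M = L - {0} \<and> L - {0} = K - {0} \<and> maximal_subfield K)"
  proof (cases "L = center_D")
    case True
    then show ?thesis using AeqL by simp
  next
    case False
    have normK: "m * k * inverse m \<in> K" if m: "m \<in> M" and k: "k \<in> K" for m k
    proof -
      have m0: "m \<noteq> 0" using m MU by auto
      have "m * k * inverse m * l = l * (m * k * inverse m)" if l: "l \<in> L" for l
      proof -
        define l' where "l' = inverse m * l * m"
        have "l' \<in> L" using normL[of "inverse m" l] m MU l unfolding l'_def by (metis inverse_inverse_eq)
        then have kl: "k * l' = l' * k" using k by (simp add: K_def centralizer_def)
        have "l = m * l' * inverse m" using m0 by (simp add: l'_def mult.assoc inverse_cancel)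
        then show ?thesis using m0 by (simp add: mult.assoc inverse_cancel left_commute[OF kl])
      qed
      then show ?thesis by (simp add: K_def centralizer_def)
    qed
    have KM: "K - {0} \<subseteq> M"
    proof (rule ccontr)
      assume "\<not> K - {0} \<subseteq> M"
      then have "K = UNIV \<or> K \<subseteq> center_D"
        using maximal_subgroup_dichotomy[OF maxM Ksub normK] by blast
      \<comment> \<open>\<open>K = UNIV\<close> says that everything commutes with \<open>L\<close>;
        if \<open>K\<close> is central, so is its subset \<open>L\<close>.\<close>
      then have "L \<subseteq> center_D"
      proof
        assume "K = UNIV"
        then have "y * l = l * y" if "l \<in> L" for l y using that by (auto simp: K_def centralizer_def)
        then show ?thesis by (auto simp: center_D_def)
      qed (use LK in auto)
      then show False using False FL by auto
    qed
    have "abelian_set K"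
    proof (rule abelian_set_of_class_two[OF Ksub])
      fix S assume S: "finite S" "S \<subseteq> K - {0}" "\<not> abelian_set S"
      have "subgroup (K - {0}) (mgrp units_D)"
        unfolding subgroup_units_iff using division_subringD[OF Ksub] by auto
      then have "generate (mgrp units_D) S \<subseteq> K - {0}"
        using group.generate_subgroup_incl[OF group_units S(2)] by blast
      moreover have "0 \<notin> S" "S \<subseteq> M" using S(2) KM by auto
      ultimately show "\<exists>N\<subseteq>K. class_two N \<and> N \<subseteq> centralizer (centralizer S) \<and> (\<forall>s\<in>S. normalizes s N) \<and>
          \<not> N \<subseteq> centralizer S"
        using solvable_class_two[OF _ S(3) solv[OF S(1)]] by blast
    qed
    then have "abelian_set (K - {0})" by (auto simp: abelian_set_def)
    \<comment> \<open>The maximality of \<open>A\<close> is used a second time, now against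
      \<open>K - {0}\<close>.\<close>
    then have KA: "K - {0} = A" using Amax[OF normal_units[OF Ksub KM normK]] AeqL LK by auto
    then have KL: "K = L" using AeqL division_subringD(1)[OF Ksub] division_subringD(1)[OF Lsub] by auto
    have "centralizer A = K" by (auto simp: AeqL K_def centralizer_def)
    then have "centralizer A \<inter> M = L - {0}" using KL LM MU by auto
    moreover have "maximal_subfield K"
      unfolding maximal_subfield_def
    proof (intro conjI allI impI)
      fix K' assume K': "division_subring K' \<and> abelian_set K' \<and> K \<subseteq> K'"
      \<comment> \<open>A commutative ring containing \<open>K = L\<close> centralizes
        \<open>L\<close>, so it lies in \<open>K\<close>.\<close>
      then have "K' \<subseteq> centralizer L" using KL by (auto simp: abelian_set_def centralizer_def)
      then show "K' = K" using K' by (auto simp: K_def)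
    qed fact+
    ultimately show ?thesis using KL by simp
  qed
  then show ?thesis using AeqL unfolding L_def K_def by blast
qed

end
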